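(* Consider the 1G$n$B system with parameters $n,p_{\mathrm{gen}},p_{\mathrm{con}},q,\Gamma,F_{\mathrm{new}}$ and policy coefficients $(a_k,b_k,c_k,d_k)_{k=1}^n$. Its average consumed fidelity satisfies $$\overline F=\frac{\tilde wF_{\mathrm{new}}+\tilde x}{\tilde yF_{\mathrm{new}}+\tilde z}\quad\text{almost surely},$$ where $$\tilde w=p_{\mathrm{con}}+q(1-p_{\mathrm{con}})\left(p^*_{\mathrm{gen}}+\tfrac14\tilde c-\tilde d\right),$$ $$\tilde x=\tfrac14\left[e^{\Gamma}-1+q(1-p_{\mathrm{con}})\left(-\tilde a+4\tilde b-\tfrac14\tilde c+\tilde d\right)\right],$$ $$\tilde y=q(1-p_{\mathrm{con}})\tilde c,$$ $$\tilde z=e^{\Gamma}-1+p_{\mathrm{con}}+q(1-p_{\mathrm{con}})\left(p^*_{\mathrm{gen}}-\tilde a-\tfrac14\tilde c\right),$$ with $p^*_{\mathrm{gen}}=1-(1-p_{\mathrm{gen}})^n$, $\tilde a=\sum_{k=1}^n a_k\binom nk(1-p_{\mathrm{gen}})^{n-k}p_{\mathrm{gen}}^k$, and $\tilde b,\tilde c,\tilde d$ defined by the same formula with $a_k$ replaced by $b_k,c_k,d_k$ respectively.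
   Context: Model (1G$n$B system). Parameters: an integer $n\ge1$; $p_{\mathrm{gen}}\in(0,1]$; $p_{\mathrm{con}}\in(0,1]$; $q\in[0,1]$; $\Gamma\ge0$; $F_{\mathrm{new}}\in(1/4,1]$; and, for $k=1,\dots,n$, real constants $a_k,b_k,c_k,d_k$ (the purification policy). Put $p_k(F)=c_k(F-\frac14)+d_k$ (success probability) and $J_k(F)=\frac14+\frac{a_k(F-1/4)+b_k}{c_k(F-1/4)+d_k}$ (jump function). Physicality: for all $F\in[1/4,1]$, $0\le p_k(F)\le1$ and $0\le a_k(F-\frac14)+b_k\le\frac34p_k(F)$ (i.e. $J_k(F)\in[1/4,1]$ when $p_k(F)>0$). Dynamics. For $t=1,2,\dots$ let $X_t\sim\mathrm{Bernoulli}(p_{\mathrm{con}})$ (a consumption request arrives at time $t$), $K_t\sim\mathrm{Bin}(n,p_{\mathrm{gen}})$ (number of links generated), $Q_t\sim\mathrm{Bernoulli}(q)$ (decision to purify), $W_t\sim\mathrm{Unif}[0,1]$, all independent. $F(t)$ is the fidelity of the link stored in memory G at time $t$, with $F(t)=0$ meaning that G is empty; $F(0)=F_{\mathrm{new}}$. For $t\ge1$ let $F^-(t)=e^{-\Gamma}(F(t-1)-\frac14)+\frac14$ if $F(t-1)>0$ and $F^-(t)=0$ if $F(t-1)=0$. If $F(t-1)=0$, then $F(t)=F_{\mathrm{new}}$ if $K_t\ge1$ and $F(t)=0$ otherwise (a request, if any, is discarded). If $F(t-1)>0$: when $X_t=1$ the link is consumed, $F(t)=0$; when $X_t=0$, $K_t\ge1$,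 $Q_t=1$, purification is attempted, and with $k=K_t$, $F(t)=J_k(F^-(t))$ if $W_t<p_k(F^-(t))$ (success) and $F(t)=0$ otherwise (failure); in all remaining cases $F(t)=F^-(t)$. Let $T^{(j)}_{\mathrm{con}}$ be the $j$-th time $t\ge1$ with $X_t=1$. The average consumed fidelity is $$\overline F=\lim_{m\to\infty}\frac{\sum_{j=1}^m F^-(T^{(j)}_{\mathrm{con}})\,\mathbb 1\{F^-(T^{(j)}_{\mathrm{con}})>0\}}{\sum_{j=1}^m\mathbb 1\{F^-(T^{(j)}_{\mathrm{con}})>0\}}.$$ *)

theory Defs
  imports "HOL-Probability.Probability" "HOL-Library.Infinite_Set"
begin

definition succ_prob :: "(nat \<Rightarrow> real) \<Rightarrow> (nat \<Rightarrow> real) \<Rightarrow> nat \<Rightarrow> real \<Rightarrow> real" where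
  "succ_prob c d k F = c k * (F - 1/4) + d k"

definition jump ::
    "(nat \<Rightarrow> real) \<Rightarrow> (nat \<Rightarrow> real) \<Rightarrow> (nat \<Rightarrow> real) \<Rightarrow> (nat \<Rightarrow> real) \<Rightarrow> nat \<Rightarrow> real \<Rightarrow> real" where
  "jump a b c d k F = 1/4 + (a k * (F - 1/4) + b k) / (c k * (F - 1/4) + d k)"

text \<open>The condition on the numerator says that the jump function takes values in
  \<open>[1/4, 1]\<close> wherever the success probability is positive.\<close>

definition physical_policy ::
    "nat \<Rightarrow> (nat \<Rightarrow> real) \<Rightarrow> (nat \<Rightarrow> real) \<Rightarrow> (nat \<Rightarrow> real) \<Rightarrow> (nat \<Rightarrow> real) \<Rightarrow> bool" where
  "physical_policy n a b c d \<longleftrightarrow>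
     (\<forall>k\<in>{1..n}. \<forall>F\<in>{1/4..1}.
        0 \<le> succ_prob c d k F \<and> succ_prob c d k F \<le> 1 \<and>
        0 \<le> a k * (F - 1/4) + b k \<and> a k * (F - 1/4) + b k \<le> 3/4 * succ_prob c d k F)"

text \<open>Fidelity after one time step of decoherence. Fidelity \<open>0\<close> encodes an empty memory.\<close>

definition decay :: "real \<Rightarrow> real \<Rightarrow> real" where
  "decay \<Gamma> F = (if F > 0 then exp (- \<Gamma>) * (F - 1/4) + 1/4 else 0)"

text \<open>The dynamics are defined path by path: \<open>x t\<close> (a request arrives), \<open>k t\<close> (number of
  generated links), \<open>p t\<close> (decision to purify) and \<open>w t\<close> (uniform variable deciding
  whether purification succeeds) are realisations of the driving variables. Only their values
  at times \<open>t \<ge> 1\<close> are used.\<close>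

primrec fidelity ::
    "(nat \<Rightarrow> real) \<Rightarrow> (nat \<Rightarrow> real) \<Rightarrow> (nat \<Rightarrow> real) \<Rightarrow> (nat \<Rightarrow> real) \<Rightarrow> real \<Rightarrow> real \<Rightarrow>
     (nat \<Rightarrow> bool) \<Rightarrow> (nat \<Rightarrow> nat) \<Rightarrow> (nat \<Rightarrow> bool) \<Rightarrow> (nat \<Rightarrow> real) \<Rightarrow> nat \<Rightarrow> real" where
  "fidelity a b c d \<Gamma> Fnew x k p w 0 = Fnew"
| "fidelity a b c d \<Gamma> Fnew x k p w (Suc t) =
     (let F = fidelity a b c d \<Gamma> Fnew x k p w t;
          F' = decay \<Gamma> F
      in if F > 0 then
           if x (Suc t) then 0
           else if k (Suc t) \<ge> 1 \<and> p (Suc t) then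
             if w (Suc t) < succ_prob c d (k (Suc t)) F' then jump a b c d (k (Suc t)) F' else 0
           else F'
         else if k (Suc t) \<ge> 1 then Fnew else 0)"

text \<open>The fidelity just before the events of time step \<open>t\<close>; meaningful for \<open>t \<ge> 1\<close>.\<close>

definition fidelity_minus ::
    "(nat \<Rightarrow> real) \<Rightarrow> (nat \<Rightarrow> real) \<Rightarrow> (nat \<Rightarrow> real) \<Rightarrow> (nat \<Rightarrow> real) \<Rightarrow> real \<Rightarrow> real \<Rightarrow>
     (nat \<Rightarrow> bool) \<Rightarrow> (nat \<Rightarrow> nat) \<Rightarrow> (nat \<Rightarrow> bool) \<Rightarrow> (nat \<Rightarrow> real) \<Rightarrow> nat \<Rightarrow> real" where
  "fidelity_minus a b c d \<Gamma> Fnew x k p w t = decay \<Gamma> (fidelity a b c d \<Gamma> Fnew x k p w (t - 1))"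

text \<open>The \<open>j\<close>-th request time, \<open>j \<ge> 1\<close>; \<^const>\<open>enumerate\<close> counts from \<open>0\<close>.
  It is meaningful for every \<open>j\<close> only on paths with infinitely many requests, which have
  probability one when requests are independent with a fixed positive probability.\<close>

definition request_time :: "(nat \<Rightarrow> bool) \<Rightarrow> nat \<Rightarrow> nat" where
  "request_time x j = enumerate {t. t \<ge> 1 \<and> x t} (j - 1)"

text \<open>Average fidelity of the links consumed by the first \<open>m\<close> requests (\<open>0\<close> if none of
  them consumes a link).\<close>

definition avg_consumed_fidelity ::
    "(nat \<Rightarrow> real) \<Rightarrow> (nat \<Rightarrow> real) \<Rightarrow> (nat \<Rightarrow> real) \<Rightarrow> (nat \<Rightarrow> real) \<Rightarrow> real \<Rightarrow> real \<Rightarrow>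
     (nat \<Rightarrow> bool) \<Rightarrow> (nat \<Rightarrow> nat) \<Rightarrow> (nat \<Rightarrow> bool) \<Rightarrow> (nat \<Rightarrow> real) \<Rightarrow> nat \<Rightarrow> real" where
  "avg_consumed_fidelity a b c d \<Gamma> Fnew x k p w m =
     (let G = (\<lambda>j. fidelity_minus a b c d \<Gamma> Fnew x k p w (request_time x j))
      in (\<Sum>j=1..m. G j * of_bool (G j > 0)) / (\<Sum>j=1..m. of_bool (G j > 0)))"

text \<open>Joint independence of the driving variables at all times \<open>t \<ge> 1\<close> is expressed as
  independence of one family of real random variables. Embedding truth values and naturals into
  the reals does not change the generated \<open>\<sigma>\<close>-algebras.\<close>

datatype driver = Request | Generation | Decision | Outcome

primrec driving ::
    "(nat \<Rightarrow> 'a \<Rightarrow> bool) \<Rightarrow> (nat \<Rightarrow> 'a \<Rightarrow> nat) \<Rightarrow> (nat \<Rightarrow> 'a \<Rightarrow> bool) \<Rightarrow> (nat \<Rightarrow> 'a \<Rightarrow> real) \<Rightarrow>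
     driver \<Rightarrow> nat \<Rightarrow> 'a \<Rightarrow> real" where
  "driving X K Q W Request t \<omega> = of_bool (X t \<omega>)"
| "driving X K Q W Generation t \<omega> = real (K t \<omega>)"
| "driving X K Q W Decision t \<omega> = of_bool (Q t \<omega>)"
| "driving X K Q W Outcome t \<omega> = W t \<omega>"

definition binomial_mean :: "nat \<Rightarrow> real \<Rightarrow> (nat \<Rightarrow> real) \<Rightarrow> real" where
  "binomial_mean n p f = (\<Sum>k=1..n. f k * real (n choose k) * (1 - p) ^ (n - k) * p ^ k)"

end

theory Submission imports Defs begin

text \<open>Let \<open>o\<^sub>t\<close> indicate that the memory is occupied at time \<open>t\<close> and let \<open>h\<^sub>t\<close> be the excess of the
  decohered fidelity over \<open>1/4\<close> (\<open>0\<close> for an empty memory). Since purification succeeds with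
  probability equal to the denominator of the jump function, the conditional mean of
  \<open>(o\<^sub>t\<^sub>+\<^sub>1, h\<^sub>t\<^sub>+\<^sub>1)\<close> given the past is affine in \<open>(o\<^sub>t, h\<^sub>t)\<close>. The deviations from it are
  bounded and orthogonal, so their averages vanish almost surely, and the time averages of \<open>o\<close>
  and \<open>h\<close> asymptotically satisfy two linear equations, which determine their ratio. The same law of
  large numbers shows that sampling at request times multiplies both averages by \<open>p_con\<close>, so the
  average consumed fidelity tends to \<open>1/4\<close> plus that ratio.\<close>

section \<open>A strong law for bounded orthogonal sequences\<close>

text \<open>No stationary law of the fidelity process is constructed, and the averages of occupation
  and excess are not shown to converge separately: only their ratio is needed, and the term
  contributed by the empty memory cancels between the two equations. The obstacle is the
  purification step. Its success threshold and its jump function depend on the number of links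
  generated in the same step, so they are not determined by the past. Splitting by the value
  \<open>k\<close> of that number turns the step into a finite sum in which threshold and jump are
  functions of the past alone, multiplied by an indicator of \<open>K = k\<close>. The uniform
  outcome variable can then be integrated out first, with the other drivers of the step held
  fixed.\<close>

lemma (in prob_space) AE_bounded_integrable:
  fixes f :: "'a \<Rightarrow> real"
  assumes "f \<in> borel_measurable M" "AE \<omega> in M. \<bar>f \<omega>\<bar> \<le> B"
  shows "integrable M f"
  using assms by (intro integrable_const_bound[where B = B]) auto

lemma (in prob_space) second_moment_sum_orthogonal_le:
  fixes D :: "nat \<Rightarrow> 'a \<Rightarrow> real"
  assumes [measurable]: "\<And>t. D t \<in> borel_measurable M"
    and bound: "\<And>t. AE \<omega> in M. \<bar>D t \<omega>\<bar> \<le> B"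
    and orth: "\<And>s t. s < t \<Longrightarrow> expectation (\<lambda>\<omega>. D s \<omega> * D t \<omega>) = 0"
  shows "expectation (\<lambda>\<omega>. (\<Sum>t<N. D t \<omega>)\<^sup>2) \<le> B\<^sup>2 * real N"
proof (induction N)
  case (Suc N)
  have bprod: "AE \<omega> in M. \<bar>D s \<omega> * D t \<omega>\<bar> \<le> B\<^sup>2" for s t
    using bound[of s] bound[of t]
    by eventually_elim (auto simp: abs_mult power2_eq_square intro!: mult_mono)
  have int: "integrable M (\<lambda>\<omega>. D s \<omega> * D t \<omega>)" for s t
    by (rule AE_bounded_integrable[OF _ bprod]) measurable
  \<comment> \<open>The double sum reduces integrability of the square to that of the pairwise
    products.\<close>
  have sq: "(\<Sum>t<N. D t \<omega>)\<^sup>2 = (\<Sum>s<N. \<Sum>t<N. D s \<omega> * D t \<omega>)" for \<omega>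
    by (simp add: power2_eq_square sum_product)
  have eq: "(\<Sum>t<Suc N. D t \<omega>)\<^sup>2
      = (\<Sum>t<N. D t \<omega>)\<^sup>2 + 2 * (\<Sum>s<N. D s \<omega> * D N \<omega>) + D N \<omega> * D N \<omega>" for \<omega>
    by (simp add: power2_eq_square algebra_simps sum_distrib_left)
  have "expectation (\<lambda>\<omega>. (\<Sum>t<Suc N. D t \<omega>)\<^sup>2)
      = expectation (\<lambda>\<omega>. (\<Sum>t<N. D t \<omega>)\<^sup>2) + 2 * (\<Sum>s<N. expectation (\<lambda>\<omega>. D s \<omega> * D N \<omega>))
        + expectation (\<lambda>\<omega>. D N \<omega> * D N \<omega>)"
    unfolding eq sq using int by (simp add: Bochner_Integration.integral_sum)
  also have "(\<Sum>s<N. expectation (\<lambda>\<omega>. D s \<omega> * D N \<omega>)) = 0"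
    using orth by simp
  also have "expectation (\<lambda>\<omega>. D N \<omega> * D N \<omega>) \<le> expectation (\<lambda>\<omega>. B\<^sup>2)"
    using bprod[of N N] by (intro integral_mono_AE int) auto
  finally show ?case
    using Suc by (simp add: prob_space algebra_simps)
qed simp

text \<open>Let \<open>r\<close> be the integer part of sqrt N. At most 2 * sqrt N terms lie between
  r^2 and N, each bounded by B, so they change the average by O(1 / sqrt N). For the remaining
  terms, dividing by r^2 instead of N only increases the absolute value.\<close>

lemma averages_tendsto_0_from_squares:
  fixes u :: "nat \<Rightarrow> real"
  assumes bound: "\<And>t. \<bar>u t\<bar> \<le> B"
    and lim: "(\<lambda>m. (\<Sum>t<m\<^sup>2. u t) / real (m\<^sup>2)) \<longlonglongrightarrow> 0"
  shows "(\<lambda>N. (\<Sum>t<N. u t) / real N) \<longlonglongrightarrow> 0"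
proof -
  define r where "r N = nat \<lfloor>sqrt (real N)\<rfloor>" for N
  have r_le: "real (r N) \<le> sqrt (real N)" and r_gt: "sqrt (real N) < real (r N) + 1" for N
    unfolding r_def by simp_all
  have r_sq: "(r N)\<^sup>2 \<le> N" for N
  proof -
    have "(real (r N))\<^sup>2 \<le> (sqrt (real N))\<^sup>2"
      by (intro power_mono r_le) simp
    then have "real ((r N)\<^sup>2) \<le> real N" by simp
    then show ?thesis by (simp only: of_nat_le_iff)
  qed
  have gap: "real N - (real (r N))\<^sup>2 \<le> 2 * sqrt (real N)" for N
  proof -
    have "real N - (real (r N))\<^sup>2 = (sqrt (real N) - real (r N)) * (sqrt (real N) + real (r N))"
      by (simp add: algebra_simps power2_eq_square)
    also have "\<dots> \<le> 1 * (2 * sqrt (real N))"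
      using r_le[of N] r_gt[of N] by (intro mult_mono) auto
    finally show ?thesis by simp
  qed
  have r_top: "filterlim r at_top sequentially"
    unfolding r_def
    by (intro filterlim_compose[OF filterlim_nat_sequentially]
          filterlim_compose[OF filterlim_floor_sequentially]
          filterlim_compose[OF sqrt_at_top] filterlim_real_sequentially)
  have B: "B \<ge> 0" using bound[of 0] by linarith
  have "\<bar>(\<Sum>t<N. u t) / real N\<bar>
      \<le> \<bar>(\<Sum>t<(r N)\<^sup>2. u t) / real ((r N)\<^sup>2)\<bar> + 2 * B * (sqrt (real N) / real N)" if "N > 0" for N
  proof -
    have "1 \<le> r N" using that unfolding r_def by (simp add: le_nat_iff)
    then have rpos: "0 < (r N)\<^sup>2" by simp
    have "(\<Sum>t<N. u t) = (\<Sum>t<(r N)\<^sup>2. u t) + (\<Sum>t\<in>{(r N)\<^sup>2..<N}. u t)"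
      using r_sq[of N] by (simp add: lessThan_atLeast0 sum.atLeastLessThan_concat)
    moreover have "\<bar>\<Sum>t\<in>{(r N)\<^sup>2..<N}. u t\<bar> \<le> (real N - (real (r N))\<^sup>2) * B"
      using sum_bounded_above[of "{(r N)\<^sup>2..<N}" "\<lambda>t. \<bar>u t\<bar>" B] bound r_sq[of N]
        sum_abs[of u "{(r N)\<^sup>2..<N}"] by (intro order_trans[OF sum_abs]) (simp add: of_nat_diff)
    moreover have "\<dots> \<le> (2 * sqrt (real N)) * B"
      by (intro mult_right_mono gap B)
    ultimately have "\<bar>\<Sum>t<N. u t\<bar> \<le> \<bar>\<Sum>t<(r N)\<^sup>2. u t\<bar> + 2 * B * sqrt (real N)"
      by (simp add: algebra_simps)
    then have "\<bar>\<Sum>t<N. u t\<bar> / real N \<le> \<bar>\<Sum>t<(r N)\<^sup>2. u t\<bar> / real N + 2 * B * sqrt (real N) / real N"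
      by (metis add_divide_distrib divide_right_mono of_nat_0_le_iff)
    moreover have "\<bar>\<Sum>t<(r N)\<^sup>2. u t\<bar> / real N \<le> \<bar>\<Sum>t<(r N)\<^sup>2. u t\<bar> / real ((r N)\<^sup>2)"
      using rpos r_sq[of N] that
      by (intro divide_left_mono mult_pos_pos)
        (simp_all only: of_nat_le_iff of_nat_0_less_iff abs_ge_zero)
    ultimately show ?thesis by (simp add: abs_divide)
  qed
  then have ev: "\<forall>\<^sub>F N in sequentially. norm ((\<Sum>t<N. u t) / real N)
      \<le> \<bar>(\<Sum>t<(r N)\<^sup>2. u t) / real ((r N)\<^sup>2)\<bar> + 2 * B * (sqrt (real N) / real N)"
    by (intro eventually_mono[OF eventually_gt_at_top[of 0]]) simp
  have "(\<lambda>N. \<bar>(\<Sum>t<(r N)\<^sup>2. u t) / real ((r N)\<^sup>2)\<bar> + 2 * B * (sqrt (real N) / real N)) \<longlonglongrightarrow> \<bar>0\<bar> + 2 * B * 0"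
  proof (intro tendsto_intros)
    show "(\<lambda>N. (\<Sum>t<(r N)\<^sup>2. u t) / real ((r N)\<^sup>2)) \<longlonglongrightarrow> 0"
      by (rule filterlim_compose[OF lim r_top])
    have "(\<lambda>N. inverse (sqrt (real N))) \<longlonglongrightarrow> 0"
      by (intro tendsto_inverse_0_at_top filterlim_compose[OF sqrt_at_top] filterlim_real_sequentially)
    then show "(\<lambda>N. sqrt (real N) / real N) \<longlonglongrightarrow> 0"
      by (simp add: inverse_eq_divide real_div_sqrt sqrt_divide_self_eq)
  qed
  then show ?thesis
    by (intro Lim_null_comparison[OF ev]) simp
qed

text \<open>Along the squares the second moments \<open>B\<^sup>2 / m\<^sup>2\<close> of the averages are summable; the gaps
  between consecutive squares are filled using boundedness.\<close>

lemma (in prob_space) strong_law_bounded_orthogonal: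
  fixes D :: "nat \<Rightarrow> 'a \<Rightarrow> real"
  assumes [measurable]: "\<And>t. D t \<in> borel_measurable M"
    and bound: "\<And>t. AE \<omega> in M. \<bar>D t \<omega>\<bar> \<le> B"
    and orth: "\<And>s t. s < t \<Longrightarrow> expectation (\<lambda>\<omega>. D s \<omega> * D t \<omega>) = 0"
  shows "AE \<omega> in M. (\<lambda>N. (\<Sum>t<N. D t \<omega>) / real N) \<longlonglongrightarrow> 0"
proof -
  define Z where "Z m \<omega> = ((\<Sum>t<m\<^sup>2. D t \<omega>) / real (m\<^sup>2))\<^sup>2" for m \<omega>
  have [measurable]: "Z m \<in> borel_measurable M" for m
    unfolding Z_def by measurable
  have all_bound: "AE \<omega> in M. \<forall>t. \<bar>D t \<omega>\<bar> \<le> B"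
    using bound by (simp add: AE_all_countable)
  have "(\<integral>\<^sup>+\<omega>. ennreal (Z m \<omega>) \<partial>M) \<le> ennreal (B\<^sup>2 / real m ^ 2)" for m
  \<comment> \<open>For m = 0 the average is 0 / 0 = 0, so the bound is trivial.\<close>
  proof (cases "m = 0")
    case False
    have "AE \<omega> in M. \<bar>(\<Sum>t<m\<^sup>2. D t \<omega>)\<^sup>2\<bar> \<le> (real (m\<^sup>2) * B)\<^sup>2"
      using all_bound
    proof eventually_elim
      case (elim \<omega>)
      have "\<bar>\<Sum>t<m\<^sup>2. D t \<omega>\<bar> \<le> (\<Sum>t<m\<^sup>2. \<bar>D t \<omega>\<bar>)" by (rule sum_abs)
      also have "\<dots> \<le> real (m\<^sup>2) * B"
        using sum_bounded_above[of "{..<m\<^sup>2}" "\<lambda>t. \<bar>D t \<omega>\<bar>" B] elim by simp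
      finally have "\<bar>\<Sum>t<m\<^sup>2. D t \<omega>\<bar>\<^sup>2 \<le> (real (m\<^sup>2) * B)\<^sup>2" by (rule power_mono) simp
      then show ?case by simp
    qed
    then have int: "integrable M (\<lambda>\<omega>. (\<Sum>t<m\<^sup>2. D t \<omega>)\<^sup>2)"
      by (intro AE_bounded_integrable) auto
    have "(\<integral>\<^sup>+\<omega>. ennreal (Z m \<omega>) \<partial>M) = ennreal (expectation (Z m))"
      unfolding Z_def power_divide using int by (intro nn_integral_eq_integral) auto
    also have "expectation (Z m) = expectation (\<lambda>\<omega>. (\<Sum>t<m\<^sup>2. D t \<omega>)\<^sup>2) / (real (m\<^sup>2))\<^sup>2"
      unfolding Z_def power_divide by simp
    also have "\<dots> \<le> B\<^sup>2 * real (m\<^sup>2) / (real (m\<^sup>2))\<^sup>2"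
      using second_moment_sum_orthogonal_le[OF assms, where N = "m\<^sup>2"] by (intro divide_right_mono) auto
    also have "\<dots> = B\<^sup>2 / real m ^ 2"
      using False by (simp add: power2_eq_square field_simps)
    finally show ?thesis by (auto intro: ennreal_leI)
  qed (simp add: Z_def)
  then have "(\<Sum>m. \<integral>\<^sup>+\<omega>. ennreal (Z m \<omega>) \<partial>M) \<le> (\<Sum>m. ennreal (B\<^sup>2 / real m ^ 2))"
    by (intro suminf_le summableI)
  also have "\<dots> = ennreal (\<Sum>m. B\<^sup>2 / real m ^ 2)"
    using summable_mult[OF inverse_power_summable[of 2, where 'a = real], of "B\<^sup>2"]
    by (intro suminf_ennreal2) (auto simp: field_simps)
  also have "\<dots> < \<infinity>" by simp
  \<comment> \<open>The series of the \<open>Z m\<close> has finite expectation, hence converges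
    almost surely, and its terms tend to 0. This takes the place of a Borel-Cantelli
    argument.\<close>
  finally have "(\<integral>\<^sup>+\<omega>. (\<Sum>m. ennreal (Z m \<omega>)) \<partial>M) \<noteq> \<infinity>"
    by (subst nn_integral_suminf) auto
  then have "AE \<omega> in M. (\<Sum>m. ennreal (Z m \<omega>)) \<noteq> \<infinity>"
    by (intro nn_integral_noteq_infinite) auto
  with all_bound show ?thesis
  proof eventually_elim
    case (elim \<omega>)
    have "summable (\<lambda>m. Z m \<omega>)"
      using elim by (intro summable_suminf_not_top) (auto simp: Z_def)
    then have "(\<lambda>m. sqrt (Z m \<omega>)) \<longlonglongrightarrow> sqrt 0"
      by (intro tendsto_real_sqrt summable_LIMSEQ_zero)
    then have "(\<lambda>m. (\<Sum>t<m\<^sup>2. D t \<omega>) / real (m\<^sup>2)) \<longlonglongrightarrow> 0"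
      by (intro tendsto_rabs_zero_cancel[of "\<lambda>m. (\<Sum>t<m\<^sup>2. D t \<omega>) / real (m\<^sup>2)"]) (simp add: Z_def)
    then show ?case
      using elim by (intro averages_tendsto_0_from_squares) auto
  qed
qed

section \<open>Functions of disjoint groups of independent variables\<close>

locale independent_reals = prob_space M for M :: "'a measure" +
  fixes V :: "'i \<Rightarrow> 'a \<Rightarrow> real" and I :: "'i set"
  assumes indep: "indep_vars (\<lambda>_. borel) V I"
begin

text \<open>The sigma-algebra of the variables indexed by \<open>A\<close>, pulled back along the
  restricted tuple because \<open>indep_var_restrict\<close> asserts independence of exactly such
  tuples.\<close>

definition generated :: "'i set \<Rightarrow> 'a measure" where
  "generated A = vimage_algebra (space M) (\<lambda>\<omega>. \<lambda>i\<in>A. V i \<omega>) (PiM A (\<lambda>_. borel))"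

lemma space_generated [simp]: "space (generated A) = space M"
  by (simp add: generated_def)

lemma measurable_generated:
  assumes "i \<in> A"
  shows "V i \<in> borel_measurable (generated A)"
proof -
  have "(\<lambda>\<omega>. \<lambda>i\<in>A. V i \<omega>) \<in> measurable (generated A) (PiM A (\<lambda>_. borel))"
    unfolding generated_def by (rule measurable_vimage_algebra1) (auto simp: space_PiM)
  from measurable_compose[OF this measurable_component_singleton[OF assms]] assms
  show ?thesis by simp
qed

text \<open>Minimality of the generated sigma-algebra. Monotonicity in the index set and
  measurability with respect to \<open>M\<close> are both instances.\<close>

lemma generated_measurable_trans:
  assumes "f \<in> measurable (generated A) N" "space L = space M"
    and "\<And>i. i \<in> A \<Longrightarrow> V i \<in> borel_measurable L"
  shows "f \<in> measurable L N"
proof -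
  have "(\<lambda>\<omega>. \<omega>) \<in> measurable L (generated A)"
    unfolding generated_def using assms
    by (intro measurable_vimage_algebra2) (auto intro!: measurable_restrict)
  from measurable_compose[OF this assms(1)] show ?thesis by simp
qed

lemma generated_mono:
  assumes "f \<in> measurable (generated A) N" "A \<subseteq> B"
  shows "f \<in> measurable (generated B) N"
  using assms by (intro generated_measurable_trans[OF assms(1)]) (auto intro: measurable_generated)

lemma generated_random_variable:
  assumes "f \<in> measurable (generated A) N" "A \<subseteq> I"
  shows "f \<in> measurable M N"
  using assms indep
  by (intro generated_measurable_trans[OF assms(1)]) (auto simp: indep_vars_def2)

text \<open>Preimages under \<open>f\<close> and \<open>g\<close> belong to the sigma-algebras of
  the tuples over \<open>A\<close> and \<open>B\<close>, and independence is inherited by smaller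
  families of events.\<close>

lemma generated_indep_var:
  assumes f: "f \<in> measurable (generated A) N" and g: "g \<in> measurable (generated B) L"
    and AB: "A \<inter> B = {}" "A \<subseteq> I" "B \<subseteq> I"
  shows "indep_var N f L g"
proof -
  have sub: "sigma_sets (space M) {h -` S \<inter> space M |S. S \<in> sets K} \<subseteq>
      sigma_sets (space M) {(\<lambda>\<omega>. \<lambda>i\<in>C. V i \<omega>) -` S \<inter> space M |S. S \<in> sets (PiM C (\<lambda>_. borel))}"
    if "h \<in> measurable (generated C) K" for h K and C :: "'i set"
  proof -
    have "{h -` S \<inter> space M |S. S \<in> sets K} \<subseteq> sets (generated C)"
      using measurable_sets[OF that] by auto
    then have "sigma_sets (space (generated C)) {h -` S \<inter> space M |S. S \<in> sets K} \<subseteq> sets (generated C)"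
      by (rule sets.sigma_sets_subset)
    then show ?thesis by (simp add: generated_def sets_vimage_algebra)
  qed
  have "indep_set
      (sigma_sets (space M) {(\<lambda>\<omega>. \<lambda>i\<in>A. V i \<omega>) -` S \<inter> space M |S. S \<in> sets (PiM A (\<lambda>_. borel))})
      (sigma_sets (space M) {(\<lambda>\<omega>. \<lambda>i\<in>B. V i \<omega>) -` S \<inter> space M |S. S \<in> sets (PiM B (\<lambda>_. borel))})"
    using indep_var_restrict[OF indep AB] by (simp add: indep_var_eq)
  then have "indep_set (sigma_sets (space M) {f -` S \<inter> space M |S. S \<in> sets N})
      (sigma_sets (space M) {g -` S \<inter> space M |S. S \<in> sets L})"
    unfolding indep_set_def
    by (rule indep_sets_mono_sets) (auto split: bool.split dest: subsetD[OF sub[OF f]] subsetD[OF sub[OF g]])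
  then show ?thesis
    using generated_random_variable[OF f] generated_random_variable[OF g] AB
    by (simp add: indep_var_eq)
qed

lemma expectation_mult_generated:
  fixes Y Z :: "'a \<Rightarrow> real"
  assumes Z: "Z \<in> borel_measurable (generated A)" "AE \<omega> in M. \<bar>Z \<omega>\<bar> \<le> B"
    and Y: "Y \<in> borel_measurable (generated C)" "AE \<omega> in M. \<bar>Y \<omega>\<bar> \<le> B'"
    and AC: "A \<inter> C = {}" "A \<subseteq> I" "C \<subseteq> I"
  shows "expectation (\<lambda>\<omega>. Z \<omega> * Y \<omega>) = expectation Z * expectation Y"
  using generated_indep_var[OF Z(1) Y(1) AC] generated_random_variable[OF Z(1)]
    generated_random_variable[OF Y(1)] AC Z(2) Y(2)
  by (intro indep_var_lebesgue_integral) (auto intro: AE_bounded_integrable)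

text \<open>Freeze \<open>Z\<close> and \<open>R\<close> by Fubini: for a fixed r in [0, 1] a
  uniform variable falls below r with probability r.\<close>

lemma expectation_uniform_threshold:
  fixes Z R :: "'a \<Rightarrow> real"
  assumes Z: "Z \<in> borel_measurable (generated A)" "AE \<omega> in M. \<bar>Z \<omega>\<bar> \<le> B"
    and R: "R \<in> borel_measurable (generated A)" "AE \<omega> in M. 0 \<le> R \<omega> \<and> R \<omega> \<le> 1"
    and A: "A \<subseteq> I" and i: "i \<in> I" "i \<notin> A"
    and U: "distr M borel (V i) = uniform_measure lborel {0..1}"
  shows "expectation (\<lambda>\<omega>. Z \<omega> * of_bool (V i \<omega> < R \<omega>)) = expectation (\<lambda>\<omega>. Z \<omega> * R \<omega>)"
proof -
  let ?U = "uniform_measure lborel {0..1::real}"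
  let ?S = "borel \<Otimes>\<^sub>M borel :: (real \<times> real) measure"
  \<comment> \<open>Independence of two variables is stated for a common value type, so
    \<open>V i\<close> is padded by a constant 0 to match the pair of \<open>Z\<close> and
    \<open>R\<close>.\<close>
  let ?D = "distr M ?S (\<lambda>\<omega>. (Z \<omega>, R \<omega>))" and ?E = "distr M ?S (\<lambda>\<omega>. (V i \<omega>, 0))"
  have [measurable]: "Z \<in> borel_measurable M" "R \<in> borel_measurable M"
    "V i \<in> borel_measurable M"
    using Z(1) R(1) A i indep generated_random_variable by (auto simp: indep_vars_def2)
  have "(\<lambda>\<omega>. (Z \<omega>, R \<omega>)) \<in> measurable (generated A) ?S"
    using Z(1) R(1) by measurable
  moreover have "(\<lambda>\<omega>. (V i \<omega>, 0)) \<in> measurable (generated {i}) ?S"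
    using measurable_generated[of i "{i}"] by simp
  ultimately have "indep_var ?S (\<lambda>\<omega>. (Z \<omega>, R \<omega>)) ?S (\<lambda>\<omega>. (V i \<omega>, 0))"
    using A i by (intro generated_indep_var[of _ A _ _ "{i}"]) auto
  then have prod: "distr M (?S \<Otimes>\<^sub>M ?S) (\<lambda>\<omega>. ((Z \<omega>, R \<omega>), (V i \<omega>, 0))) = ?D \<Otimes>\<^sub>M ?E"
    by (simp add: indep_var_distribution_eq)
  interpret E: prob_space ?E
    by (rule prob_space_distr) measurable
  interpret D: prob_space ?D
    by (rule prob_space_distr) measurable
  interpret P: pair_prob_space ?D ?E ..
  let ?f = "\<lambda>x. fst (fst x) * of_bool (fst (snd x) < snd (fst x)) :: real"
  have [measurable]: "?f \<in> borel_measurable (?S \<Otimes>\<^sub>M ?S)"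
    by measurable
  have int: "integrable (distr M (?S \<Otimes>\<^sub>M ?S) (\<lambda>\<omega>. ((Z \<omega>, R \<omega>), (V i \<omega>, 0)))) ?f"
    using Z(2) by (subst integrable_distr_eq) (auto intro!: AE_bounded_integrable[where B = B] elim!: eventually_mono)
  \<comment> \<open>Here the threshold is an arbitrary real, hence the clamp to [0, 1]. It
    disappears under the outer expectation, where \<open>R\<close> lies in [0, 1] almost
    surely.\<close>
  have inner: "(\<integral>y. ?f (x, y) \<partial>?E) = fst x * max 0 (min 1 (snd x))" for x
  proof -
    obtain z r where x: "x = (z, r)" by (cases x)
    have "(\<integral>y. ?f (x, y) \<partial>?E) = expectation (\<lambda>\<omega>. z * of_bool (V i \<omega> < r))"
      unfolding x by (subst integral_distr) auto
    also have "\<dots> = z * (\<integral>w. of_bool (w < r) \<partial>distr M borel (V i))"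
      by (subst integral_distr) auto
    also have "(\<integral>w. of_bool (w < r) \<partial>distr M borel (V i)) = (\<integral>w. indicator {..<r} w \<partial>?U)"
      unfolding U by (simp add: indicator_def of_bool_def lessThan_def)
    also have "\<dots> = measure ?U {..<r}"
      by simp
    also have "\<dots> = measure lborel ({0..1} \<inter> {..<r})"
      by (subst measure_uniform_measure) auto
    also have "{0..1} \<inter> {..<r} = (if r \<le> 0 then {} else if r \<le> 1 then {0..<r} else {0..1})"
      by auto
    also have "measure lborel \<dots> = max 0 (min 1 r)"
      by auto
    finally show ?thesis by (simp add: x)
  qed
  have "expectation (\<lambda>\<omega>. Z \<omega> * of_bool (V i \<omega> < R \<omega>))
      = (\<integral>x. ?f x \<partial>distr M (?S \<Otimes>\<^sub>M ?S) (\<lambda>\<omega>. ((Z \<omega>, R \<omega>), (V i \<omega>, 0))))"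
    by (subst integral_distr) auto
  also have "\<dots> = (\<integral>x. (\<integral>y. ?f (x, y) \<partial>?E) \<partial>?D)"
    unfolding prod using int[unfolded prod] by (rule P.integral_fst'[symmetric])
  also have "\<dots> = expectation (\<lambda>\<omega>. Z \<omega> * max 0 (min 1 (R \<omega>)))"
    unfolding inner by (subst integral_distr) auto
  also have "\<dots> = expectation (\<lambda>\<omega>. Z \<omega> * R \<omega>)"
  proof (rule integral_cong_AE)
    show "AE \<omega> in M. Z \<omega> * max 0 (min 1 (R \<omega>)) = Z \<omega> * R \<omega>"
      using R(2) by eventually_elim auto
  qed measurable
  finally show ?thesis .
qed

end

section \<open>Deterministic limits and path properties\<close>

text \<open>Disposes of what remains after telescoping the difference between a sum and its shift by
  one step.\<close>

lemma tendsto_boundary_term: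
  fixes u :: "nat \<Rightarrow> real"
  assumes "\<And>t. \<bar>u t\<bar> \<le> B"
  shows "(\<lambda>N. (u N - u 0) / real N) \<longlonglongrightarrow> 0"
proof (rule Lim_null_comparison)
  show "\<forall>\<^sub>F N in sequentially. norm ((u N - u 0) / real N) \<le> 2 * B / real N"
  proof (intro always_eventually allI)
    fix N
    have "\<bar>u N - u 0\<bar> \<le> 2 * B" using assms[of N] assms[of 0] by linarith
    then show "norm ((u N - u 0) / real N) \<le> 2 * B / real N"
      by (simp add: abs_divide divide_right_mono)
  qed
  show "(\<lambda>N. 2 * B / real N) \<longlonglongrightarrow> 0" by (rule lim_const_over_n)
qed

text \<open>\<open>C\<close> need not converge, so the quotient rule for limits is not applicable;
  an eventual positive lower bound is enough.\<close>

lemma tendsto_0_divide_bounded_below: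
  fixes e C :: "nat \<Rightarrow> real"
  assumes e: "e \<longlonglongrightarrow> 0" and \<delta>: "\<delta> > 0" and C: "\<forall>\<^sub>F N in sequentially. \<delta> \<le> C N"
  shows "(\<lambda>N. e N / C N) \<longlonglongrightarrow> 0"
proof (rule Lim_null_comparison)
  show "\<forall>\<^sub>F N in sequentially. norm (e N / C N) \<le> \<bar>e N\<bar> / \<delta>"
    using C
  proof eventually_elim
    case (elim N)
    then show ?case using \<delta> by (simp add: abs_divide frac_le)
  qed
  show "(\<lambda>N. \<bar>e N\<bar> / \<delta>) \<longlonglongrightarrow> 0"
    using tendsto_divide[OF tendsto_rabs_zero[OF e] tendsto_const, of \<delta>] \<delta> by simp
qed

text \<open>\<open>Occ\<close> and \<open>H\<close> are time averages obeying the stationarity equations up to \<open>o(1)\<close>, and \<open>C\<close>,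
  \<open>G\<close> are their counterparts at request times. The first equation keeps \<open>Occ\<close> away from \<open>0\<close>;
  adding \<open>f\<close> times the first to the second makes
  \<open>(\<epsilon> - \<beta> + f * \<gamma>) * H - (\<eta> + f * \<alpha>) * Occ\<close> vanish in the limit.\<close>

lemma stationary_averages_ratio:
  fixes Occ H C G :: "nat \<Rightarrow> real"
  assumes pos: "0 < p" "0 < r" "0 < \<epsilon> - \<beta> + f * \<gamma>"
    and H: "\<And>N. 0 \<le> H N" "\<And>N. H N \<le> Occ N"
    and eq1: "(\<lambda>N. p * (1 - Occ N) - \<alpha> * Occ N + \<gamma> * H N) \<longlonglongrightarrow> 0"
    and eq2: "(\<lambda>N. \<epsilon> * H N - (f * p * (1 - Occ N) + \<beta> * H N + \<eta> * Occ N)) \<longlonglongrightarrow> 0"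
    and C: "(\<lambda>N. C N - r * Occ N) \<longlonglongrightarrow> 0"
    and G: "(\<lambda>N. G N - r * H N) \<longlonglongrightarrow> 0"
  shows "\<exists>\<delta>>0. \<forall>\<^sub>F N in sequentially. \<delta> \<le> C N"
    and "(\<lambda>N. G N / C N) \<longlonglongrightarrow> (\<eta> + f * \<alpha>) / (\<epsilon> - \<beta> + f * \<gamma>)"
proof -
  \<comment> \<open>Since 0 <= H <= Occ, the expression in the first equation differs from p by at
    most L * Occ. Once it is smaller than p / 2 in absolute value, Occ >= p / (2 * L). Of the
    resulting lower bound for r * Occ, one half is kept as \<open>\<delta>\<close> and the other
    absorbs the error C - r * Occ.\<close>
  define L where "L = p + \<bar>\<alpha>\<bar> + \<bar>\<gamma>\<bar>"
  define \<delta> where "\<delta> = r * (p / 2 / L) / 2"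
  have L: "L > 0" using pos by (simp add: L_def)
  have "\<forall>\<^sub>F N in sequentially. \<bar>p * (1 - Occ N) - \<alpha> * Occ N + \<gamma> * H N\<bar> < p / 2"
    using tendstoD[OF eq1, of "p / 2"] pos by simp
  then have O: "\<forall>\<^sub>F N in sequentially. p / 2 / L \<le> Occ N"
  proof eventually_elim
    case (elim N)
    have "- (\<alpha> * Occ N) \<le> \<bar>\<alpha>\<bar> * Occ N"
      using H[of N] by (metis abs_ge_minus_self minus_mult_left mult_right_mono order_trans)
    moreover have "\<gamma> * H N \<le> \<bar>\<gamma>\<bar> * Occ N"
      using H[of N] by (intro mult_mono) auto
    moreover have "- (\<gamma> * H N) \<le> \<bar>\<gamma>\<bar> * Occ N"
    proof -
      have "(- \<gamma>) * H N \<le> \<bar>\<gamma>\<bar> * Occ N"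
        using H[of N] by (intro mult_mono) auto
      then show ?thesis by simp
    qed
    moreover have "\<alpha> * Occ N \<le> \<bar>\<alpha>\<bar> * Occ N"
      using H[of N] by (intro mult_right_mono) auto
    ultimately have "p / 2 \<le> L * Occ N"
      using order_le_less_trans[OF abs_ge_self elim] by (simp add: L_def algebra_simps)
    then show ?case using L by (simp add: field_simps)
  qed
  have \<delta>: "\<delta> > 0" using pos L by (simp add: \<delta>_def)
  have "\<forall>\<^sub>F N in sequentially. \<bar>C N - r * Occ N\<bar> < \<delta>"
    using tendstoD[OF C \<delta>] by simp
  with O have Cb: "\<forall>\<^sub>F N in sequentially. \<delta> \<le> C N"
  proof eventually_elim
    case (elim N)
    have "r * (p / 2 / L) \<le> r * Occ N" using elim pos by (intro mult_left_mono) auto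
    then show ?case using elim unfolding \<delta>_def by linarith
  qed
  then show "\<exists>\<delta>>0. \<forall>\<^sub>F N in sequentially. \<delta> \<le> C N" using \<delta> by blast
  define D where "D = \<epsilon> - \<beta> + f * \<gamma>"
  define \<kappa> where "\<kappa> = (\<eta> + f * \<alpha>) / D"
  have D: "D > 0" using pos by (simp add: D_def)
  \<comment> \<open>The weights are chosen so that all occurrences of \<open>H\<close> and
    \<open>Occ\<close> cancel and only G - \<kappa> * C is left.\<close>
  have "(\<lambda>N. (G N - r * H N) - \<kappa> * (C N - r * Occ N)
      + r / D * ((\<epsilon> * H N - (f * p * (1 - Occ N) + \<beta> * H N + \<eta> * Occ N))
        + f * (p * (1 - Occ N) - \<alpha> * Occ N + \<gamma> * H N))) \<longlonglongrightarrow> 0 - \<kappa> * 0 + r / D * (0 + f * 0)"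
    by (intro tendsto_intros C G eq1 eq2)
  also have "(\<lambda>N. (G N - r * H N) - \<kappa> * (C N - r * Occ N)
      + r / D * ((\<epsilon> * H N - (f * p * (1 - Occ N) + \<beta> * H N + \<eta> * Occ N))
        + f * (p * (1 - Occ N) - \<alpha> * Occ N + \<gamma> * H N))) = (\<lambda>N. G N - \<kappa> * C N)"
  proof
    fix N
    have "(\<epsilon> * H N - (f * p * (1 - Occ N) + \<beta> * H N + \<eta> * Occ N))
        + f * (p * (1 - Occ N) - \<alpha> * Occ N + \<gamma> * H N) = D * H N - (\<eta> + f * \<alpha>) * Occ N"
      by (simp add: D_def algebra_simps)
    also have "r / D * \<dots> = r * H N - r * \<kappa> * Occ N"
      using D by (simp add: \<kappa>_def field_simps)
    finally show "(G N - r * H N) - \<kappa> * (C N - r * Occ N)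
      + r / D * ((\<epsilon> * H N - (f * p * (1 - Occ N) + \<beta> * H N + \<eta> * Occ N))
        + f * (p * (1 - Occ N) - \<alpha> * Occ N + \<gamma> * H N)) = G N - \<kappa> * C N"
      by (simp add: algebra_simps)
  qed
  finally have "(\<lambda>N. G N - \<kappa> * C N) \<longlonglongrightarrow> 0" by simp
  from tendsto_0_divide_bounded_below[OF this \<delta> Cb]
  have "(\<lambda>N. (G N - \<kappa> * C N) / C N + \<kappa>) \<longlonglongrightarrow> 0 + \<kappa>"
    by (intro tendsto_intros)
  moreover have "\<forall>\<^sub>F N in sequentially. (G N - \<kappa> * C N) / C N + \<kappa> = G N / C N"
    using Cb by eventually_elim (use \<delta> in \<open>simp add: field_simps\<close>)
  ultimately have "(\<lambda>N. G N / C N) \<longlonglongrightarrow> \<kappa>"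
    using tendsto_cong by fastforce
  then show "(\<lambda>N. G N / C N) \<longlonglongrightarrow> (\<eta> + f * \<alpha>) / (\<epsilon> - \<beta> + f * \<gamma>)"
    by (simp add: \<kappa>_def D_def)
qed

text \<open>As \<open>enumerate\<close> counts from 0, its value at m is the request time number m +
  1, and the requests strictly before it are the first m ones. Writing each time as
  \<open>Suc s\<close> lowers the bound on s by one.\<close>

lemma sum_request_times:
  fixes g :: "nat \<Rightarrow> real"
  assumes inf: "infinite {t. t \<ge> 1 \<and> x t}"
  shows "(\<Sum>j=1..m. g (request_time x j))
    = (\<Sum>s<enumerate {t. t \<ge> 1 \<and> x t} m - 1. of_bool (x (Suc s)) * g (Suc s))"
proof -
  let ?S = "{t. t \<ge> 1 \<and> x t}"
  let ?e = "enumerate ?S"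
  have img: "?e ` {..<m} = {t \<in> ?S. t < ?e m}"
  proof safe
    fix j assume "j < m"
    then show "?e j < ?e m" using inf by (simp add: enumerate_mono)
    show "1 \<le> ?e j" "x (?e j)" using enumerate_in_set[OF inf, of j] by auto
  next
    fix t assume t: "t < ?e m" "1 \<le> t" "x t"
    then obtain j where j: "?e j = t"
      using enumerate_Ex[OF inf, of t] by auto
    then have "j < m" using t(1) inf by (metis enumerate_mono_iff)
    then show "t \<in> ?e ` {..<m}" using j by auto
  qed
  have "(\<Sum>j=1..m. g (request_time x j)) = (\<Sum>j<m. g (?e j))"
    unfolding request_time_def
    by (rule sum.reindex_bij_witness[of _ Suc "\<lambda>j. j - 1"]) auto
  also have "\<dots> = sum g (?e ` {..<m})"
    using inf by (subst sum.reindex) (auto simp: strict_mono_enumerate strict_mono_imp_inj_on intro: inj_on_subset)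
  also have "\<dots> = (\<Sum>t | t \<in> ?S \<and> t < ?e m. g t)"
    unfolding img by simp
  also have "\<dots> = (\<Sum>s | s < ?e m - 1 \<and> x (Suc s). g (Suc s))"
    by (rule sum.reindex_bij_witness[of _ Suc "\<lambda>t. t - 1"]) auto
  also have "\<dots> = (\<Sum>s<?e m - 1. of_bool (x (Suc s)) * g (Suc s))"
    by (rule sum.mono_neutral_cong_left) auto
  finally show ?thesis .
qed

lemma decay_in_range:
  assumes "\<Gamma> \<ge> 0" "1/4 \<le> F" "F \<le> 1"
  shows "1/4 \<le> decay \<Gamma> F" "decay \<Gamma> F \<le> 1"
proof -
  have "exp (- \<Gamma>) * (F - 1/4) \<le> 1 * (F - 1/4)"
    using assms by (intro mult_right_mono) auto
  then show "1/4 \<le> decay \<Gamma> F" "decay \<Gamma> F \<le> 1"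
    using assms by (auto simp: decay_def)
qed

text \<open>Physicality in the variable y = F - 1/4, in which the policy is affine and which
  \<open>excess\<close> tracks.\<close>

lemma physical_policyD:
  assumes "physical_policy n a b c d" "k \<in> {1..n}" "0 \<le> y" "y \<le> 3/4"
  shows "0 \<le> c k * y + d k" "c k * y + d k \<le> 1" "0 \<le> a k * y + b k"
    "a k * y + b k \<le> 3/4 * (c k * y + d k)"
proof -
  have "y + 1/4 \<in> {1/4..1}" using assms by auto
  then have "0 \<le> succ_prob c d k (y + 1/4) \<and> succ_prob c d k (y + 1/4) \<le> 1 \<and>
      0 \<le> a k * (y + 1/4 - 1/4) + b k \<and> a k * (y + 1/4 - 1/4) + b k \<le> 3/4 * succ_prob c d k (y + 1/4)"
    using assms unfolding physical_policy_def by blast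
  then show "0 \<le> c k * y + d k" "c k * y + d k \<le> 1" "0 \<le> a k * y + b k"
    "a k * y + b k \<le> 3/4 * (c k * y + d k)"
    by (auto simp: succ_prob_def)
qed

lemma jump_in_range:
  assumes "physical_policy n a b c d" "k \<in> {1..n}" "1/4 \<le> F" "F \<le> 1"
    and "0 < succ_prob c d k F"
  shows "1/4 \<le> jump a b c d k F" "jump a b c d k F \<le> 1"
  using physical_policyD[of n a b c d k "F - 1/4"] assms
  by (auto simp: jump_def succ_prob_def field_simps)

text \<open>A successful attempt satisfies 0 <= w < success probability, so the denominator of the
  jump function is positive and physicality applies.\<close>

lemma fidelity_in_range:
  assumes "physical_policy n a b c d" "\<Gamma> \<ge> 0" "1/4 < Fnew" "Fnew \<le> 1"
    and good: "\<And>t. t \<ge> 1 \<Longrightarrow> k t \<le> n \<and> 0 \<le> w t"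
  shows "fidelity a b c d \<Gamma> Fnew x k p w t \<in> {0} \<union> {1/4..1}"
proof (induction t)
  case (Suc t)
  let ?F = "fidelity a b c d \<Gamma> Fnew x k p w t"
  show ?case
  proof (cases "?F > 0")
    case True
    then have F: "1/4 \<le> ?F" "?F \<le> 1" using Suc by auto
    note D = decay_in_range[OF assms(2) F]
    show ?thesis
      using True D good[of "Suc t"] jump_in_range[OF assms(1) _ D, of "k (Suc t)"]
      by (auto simp: Let_def)
  next
    case False
    then show ?thesis using assms by (auto simp: Let_def)
  qed
qed (use assms in auto)

section \<open>The driven system\<close>

locale purification_system =
  independent_reals M "\<lambda>(s, t). driving X K Q W s t" "UNIV \<times> {1..}"
  for M :: "'a measure"
    and X Q :: "nat \<Rightarrow> 'a \<Rightarrow> bool" and K :: "nat \<Rightarrow> 'a \<Rightarrow> nat" and W :: "nat \<Rightarrow> 'a \<Rightarrow> real" +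
  fixes n :: nat and p_gen p_con q \<Gamma> Fnew :: real and a b c d :: "nat \<Rightarrow> real"
  assumes n: "n \<ge> 1" and p_gen: "0 < p_gen" "p_gen \<le> 1" and p_con: "0 < p_con" "p_con \<le> 1"
    and q: "0 \<le> q" "q \<le> 1" and \<Gamma>: "\<Gamma> \<ge> 0" and Fnew: "1/4 < Fnew" "Fnew \<le> 1"
    and physical: "physical_policy n a b c d"
    and measurable_X: "\<And>t. t \<ge> 1 \<Longrightarrow> X t \<in> measurable M (count_space UNIV)"
    and measurable_K: "\<And>t. t \<ge> 1 \<Longrightarrow> K t \<in> measurable M (count_space UNIV)"
    and measurable_Q: "\<And>t. t \<ge> 1 \<Longrightarrow> Q t \<in> measurable M (count_space UNIV)"
    and measurable_W: "\<And>t. t \<ge> 1 \<Longrightarrow> W t \<in> borel_measurable M"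
    and distr_X: "\<And>t. t \<ge> 1 \<Longrightarrow> distr M (count_space UNIV) (X t) = measure_pmf (bernoulli_pmf p_con)"
    and distr_K: "\<And>t. t \<ge> 1 \<Longrightarrow> distr M (count_space UNIV) (K t) = measure_pmf (binomial_pmf n p_gen)"
    and distr_Q: "\<And>t. t \<ge> 1 \<Longrightarrow> distr M (count_space UNIV) (Q t) = measure_pmf (bernoulli_pmf q)"
    and distr_W: "\<And>t. t \<ge> 1 \<Longrightarrow> distr M borel (W t) = uniform_measure lborel {0..1}"
begin

text \<open>The natural filtration of the drivers. At time 0 the index set is empty, in accordance
  with the deterministic initial fidelity.\<close>

abbreviation past :: "nat \<Rightarrow> 'a measure" where
  "past t \<equiv> generated (UNIV \<times> {1..t})"

text \<open>The sigma-algebras are generated by the real embeddings. Truth values are recovered by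
  comparison with 1, naturals by taking the integer part.\<close>

lemma drivers_measurable_generated:
  shows "(Request, t) \<in> A \<Longrightarrow> X t \<in> measurable (generated A) (count_space UNIV)"
    and "(Generation, t) \<in> A \<Longrightarrow> K t \<in> measurable (generated A) (count_space UNIV)"
    and "(Decision, t) \<in> A \<Longrightarrow> Q t \<in> measurable (generated A) (count_space UNIV)"
    and "(Outcome, t) \<in> A \<Longrightarrow> W t \<in> borel_measurable (generated A)"
proof -
  assume "(Request, t) \<in> A"
  from measurable_generated[OF this]
  have [measurable]: "(\<lambda>\<omega>. of_bool (X t \<omega>) :: real) \<in> borel_measurable (generated A)"
    by (simp cong: measurable_cong)
  have "Measurable.pred (generated A) (\<lambda>\<omega>. (of_bool (X t \<omega>) :: real) = 1)"
    by measurable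
  then show "X t \<in> measurable (generated A) (count_space UNIV)" by simp
next
  assume "(Generation, t) \<in> A"
  from measurable_generated[OF this]
  have [measurable]: "(\<lambda>\<omega>. real (K t \<omega>)) \<in> borel_measurable (generated A)"
    by (simp cong: measurable_cong)
  have "(\<lambda>\<omega>. nat \<lfloor>real (K t \<omega>)\<rfloor>) \<in> measurable (generated A) (count_space UNIV)"
    by measurable
  then show "K t \<in> measurable (generated A) (count_space UNIV)" by simp
next
  assume "(Decision, t) \<in> A"
  from measurable_generated[OF this]
  have [measurable]: "(\<lambda>\<omega>. of_bool (Q t \<omega>) :: real) \<in> borel_measurable (generated A)"
    by (simp cong: measurable_cong)
  have "Measurable.pred (generated A) (\<lambda>\<omega>. (of_bool (Q t \<omega>) :: real) = 1)"
    by measurable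
  then show "Q t \<in> measurable (generated A) (count_space UNIV)" by simp
next
  assume "(Outcome, t) \<in> A"
  from measurable_generated[OF this]
  show "W t \<in> borel_measurable (generated A)"
    by (simp cong: measurable_cong)
qed

lemma past_Suc: "f \<in> measurable (past t) N \<Longrightarrow> f \<in> measurable (past (Suc t)) N"
  by (erule generated_mono) auto

lemma past_random_variable: "f \<in> measurable (past t) N \<Longrightarrow> f \<in> measurable M N"
  by (erule generated_random_variable) auto

lemma drivers_measurable_past [measurable]:
  "X (Suc t) \<in> measurable (past (Suc t)) (count_space UNIV)"
  "K (Suc t) \<in> measurable (past (Suc t)) (count_space UNIV)"
  "Q (Suc t) \<in> measurable (past (Suc t)) (count_space UNIV)"
  "W (Suc t) \<in> borel_measurable (past (Suc t))"
  by (auto intro: drivers_measurable_generated)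

section \<open>State of the memory: measurability and range\<close>

definition fid :: "nat \<Rightarrow> 'a \<Rightarrow> real" where
  "fid t \<omega> = fidelity a b c d \<Gamma> Fnew (\<lambda>t. X t \<omega>) (\<lambda>t. K t \<omega>) (\<lambda>t. Q t \<omega>) (\<lambda>t. W t \<omega>) t"

definition occ :: "nat \<Rightarrow> 'a \<Rightarrow> real" where
  "occ t \<omega> = of_bool (fid t \<omega> > 0)"

text \<open>Decay is applied in advance, so this is the argument at which the policy acts in the
  next step. The price is a factor \<open>exp \<Gamma>\<close> in front of the next excess, which is
  where \<open>exp \<Gamma>\<close> in the final formula comes from.\<close>

definition excess :: "nat \<Rightarrow> 'a \<Rightarrow> real" where
  "excess t \<omega> = exp (- \<Gamma>) * (fid t \<omega> - 1/4) * occ t \<omega>"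

lemma measurable_fid [measurable]: "fid t \<in> borel_measurable (past t)"
proof (induction t)
  case (Suc t)
  note [measurable] = past_Suc[OF Suc]
  have coeff: "(\<lambda>\<omega>. f (K (Suc t) \<omega>)) \<in> borel_measurable (past (Suc t))" for f :: "nat \<Rightarrow> real"
    by (rule measurable_compose[OF drivers_measurable_past(2)]) simp
  note [measurable] = coeff[of a] coeff[of b] coeff[of c] coeff[of d]
  define D where "D \<omega> = decay \<Gamma> (fid t \<omega>)" for \<omega>
  have [measurable]: "D \<in> borel_measurable (past (Suc t))"
    unfolding D_def decay_def by measurable
  have eq: "fid (Suc t) = (\<lambda>\<omega>.
      if fid t \<omega> > 0 then
        if X (Suc t) \<omega> then 0
        else if K (Suc t) \<omega> \<ge> 1 \<and> Q (Suc t) \<omega> then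
          if W (Suc t) \<omega> < succ_prob c d (K (Suc t) \<omega>) (D \<omega>)
          then jump a b c d (K (Suc t) \<omega>) (D \<omega>) else 0
        else D \<omega>
      else if K (Suc t) \<omega> \<ge> 1 then Fnew else 0)"
    by (simp add: fun_eq_iff fid_def D_def Let_def)
  have [measurable]: "(\<lambda>\<omega>. succ_prob c d (K (Suc t) \<omega>) (D \<omega>)) \<in> borel_measurable (past (Suc t))"
    "(\<lambda>\<omega>. jump a b c d (K (Suc t) \<omega>) (D \<omega>)) \<in> borel_measurable (past (Suc t))"
    unfolding succ_prob_def jump_def by measurable
  show ?case unfolding eq by measurable
qed (simp add: fid_def)

lemma measurable_occ [measurable]: "occ t \<in> borel_measurable (past t)"
  unfolding occ_def by measurable

lemma measurable_excess [measurable]: "excess t \<in> borel_measurable (past t)"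
  unfolding excess_def by measurable

text \<open>Off this almost sure event \<open>K\<close> may leave the range of the policy and \<open>W\<close> may fall below a
  vanishing success probability.\<close>

definition regular :: "'a \<Rightarrow> bool" where
  "regular \<omega> \<longleftrightarrow> (\<forall>t. K (Suc t) \<omega> \<le> n \<and> 0 \<le> W (Suc t) \<omega>)"

lemma AE_regular: "AE \<omega> in M. regular \<omega>"
proof -
  have "AE \<omega> in M. K (Suc t) \<omega> \<le> n" for t
  proof -
    have "AE k in measure_pmf (binomial_pmf n p_gen). k \<le> n"
      using p_gen set_pmf_binomial_eq[of p_gen n] by (auto simp: AE_measure_pmf_iff split: if_splits)
    then have "AE k in distr M (count_space UNIV) (K (Suc t)). k \<le> n"
      by (subst distr_K) auto
    then show ?thesis by (rule AE_distrD[rotated]) (simp add: measurable_K)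
  qed
  moreover have "AE \<omega> in M. 0 \<le> W (Suc t) \<omega>" for t
  proof -
    have "AE w in uniform_measure lborel {0..1}. 0 \<le> (w :: real)"
      by (intro AE_uniform_measureI) auto
    then have "AE w in distr M borel (W (Suc t)). 0 \<le> w"
      by (subst distr_W) auto
    then show ?thesis by (rule AE_distrD[rotated]) (simp add: measurable_W)
  qed
  ultimately show ?thesis
    by (simp add: regular_def AE_all_countable)
qed

lemma fid_in_range:
  assumes "regular \<omega>"
  shows "fid t \<omega> \<in> {0} \<union> {1/4..1}"
  unfolding fid_def
proof (rule fidelity_in_range[OF physical \<Gamma> Fnew])
  fix t :: nat assume "t \<ge> 1"
  then obtain s where "t = Suc s" by (cases t) auto
  then show "K t \<omega> \<le> n \<and> 0 \<le> W t \<omega>" using assms by (simp add: regular_def)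
qed

lemma occ_cases: "occ t \<omega> = 0 \<or> occ t \<omega> = 1"
  by (simp add: occ_def)

lemma excess_bounds:
  assumes "regular \<omega>"
  shows "0 \<le> excess t \<omega>" "excess t \<omega> \<le> 3/4 * occ t \<omega>" "\<bar>excess t \<omega>\<bar> \<le> 1"
proof -
  have "0 \<le> excess t \<omega> \<and> excess t \<omega> \<le> 3/4 * occ t \<omega> \<and> \<bar>excess t \<omega>\<bar> \<le> 1"
  proof (cases "fid t \<omega> > 0")
    case True
    then have F: "1/4 \<le> fid t \<omega>" "fid t \<omega> \<le> 1" using fid_in_range[OF assms, of t] by auto
    show ?thesis
      using decay_in_range[OF \<Gamma> F] True by (auto simp: excess_def occ_def decay_def)
  qed (simp add: excess_def occ_def)
  then show "0 \<le> excess t \<omega>" "excess t \<omega> \<le> 3/4 * occ t \<omega>" "\<bar>excess t \<omega>\<bar> \<le> 1" by auto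
qed

lemma decay_fid: "decay \<Gamma> (fid t \<omega>) = excess t \<omega> + 1/4 * occ t \<omega>"
  by (auto simp: excess_def occ_def decay_def)

section \<open>Martingale increments and their averages\<close>

text \<open>Bounded martingale increments for the filtration \<open>past\<close>, without conditional expectations.\<close>

definition centered :: "nat \<Rightarrow> ('a \<Rightarrow> real) \<Rightarrow> bool" where
  "centered t D \<longleftrightarrow> D \<in> borel_measurable (past (Suc t)) \<and> (\<exists>B. AE \<omega> in M. \<bar>D \<omega>\<bar> \<le> B) \<and>
     (\<forall>Z B. Z \<in> borel_measurable (past t) \<longrightarrow> (AE \<omega> in M. \<bar>Z \<omega>\<bar> \<le> B) \<longrightarrow>
        expectation (\<lambda>\<omega>. Z \<omega> * D \<omega>) = 0)"

lemma AE_abs_mult_le: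
  fixes f g :: "'a \<Rightarrow> real"
  assumes "AE \<omega> in M. \<bar>f \<omega>\<bar> \<le> B" "AE \<omega> in M. \<bar>g \<omega>\<bar> \<le> B'"
  shows "AE \<omega> in M. \<bar>f \<omega> * g \<omega>\<bar> \<le> B * B'"
  using assms by eventually_elim (auto simp: abs_mult intro!: mult_mono)

lemma centeredD:
  assumes "centered t D"
  shows "D \<in> borel_measurable (past (Suc t))" "D \<in> borel_measurable M"
    and "\<exists>B. AE \<omega> in M. \<bar>D \<omega>\<bar> \<le> B"
    and "Z \<in> borel_measurable (past t) \<Longrightarrow> AE \<omega> in M. \<bar>Z \<omega>\<bar> \<le> B \<Longrightarrow>
          integrable M (\<lambda>\<omega>. Z \<omega> * D \<omega>) \<and> expectation (\<lambda>\<omega>. Z \<omega> * D \<omega>) = 0"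
proof -
  show D: "D \<in> borel_measurable (past (Suc t))" "D \<in> borel_measurable M"
    using assms past_random_variable by (auto simp: centered_def)
  show "\<exists>B. AE \<omega> in M. \<bar>D \<omega>\<bar> \<le> B"
    using assms by (auto simp: centered_def)
  then obtain B' where B': "AE \<omega> in M. \<bar>D \<omega>\<bar> \<le> B'" by blast
  assume Z: "Z \<in> borel_measurable (past t)" "AE \<omega> in M. \<bar>Z \<omega>\<bar> \<le> B"
  have "integrable M (\<lambda>\<omega>. Z \<omega> * D \<omega>)"
    using D past_random_variable[OF Z(1)] AE_abs_mult_le[OF Z(2) B']
    by (intro AE_bounded_integrable) auto
  then show "integrable M (\<lambda>\<omega>. Z \<omega> * D \<omega>) \<and> expectation (\<lambda>\<omega>. Z \<omega> * D \<omega>) = 0"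
    using assms Z by (auto simp: centered_def)
qed

lemma centered_add:
  assumes "centered t D" "centered t E"
  shows "centered t (\<lambda>\<omega>. D \<omega> + E \<omega>)"
proof -
  obtain B B' where "AE \<omega> in M. \<bar>D \<omega>\<bar> \<le> B" "AE \<omega> in M. \<bar>E \<omega>\<bar> \<le> B'"
    using centeredD(3)[OF assms(1)] centeredD(3)[OF assms(2)] by blast
  then have "AE \<omega> in M. \<bar>D \<omega> + E \<omega>\<bar> \<le> B + B'"
    by eventually_elim auto
  then show ?thesis
    using centeredD(1)[OF assms(1)] centeredD(1)[OF assms(2)]
      centeredD(4)[OF assms(1)] centeredD(4)[OF assms(2)]
    unfolding centered_def by (auto simp: distrib_left)
qed

lemma centered_zero: "centered t (\<lambda>_. 0)"
  by (auto simp: centered_def)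

lemma centered_sum:
  assumes "\<And>k. k \<in> S \<Longrightarrow> centered t (D k)"
  shows "centered t (\<lambda>\<omega>. \<Sum>k\<in>S. D k \<omega>)"
  using assms
  by (induction S rule: infinite_finite_induct) (auto intro: centered_zero centered_add)

text \<open>The explicit one-step formulas hold only on the regular event, so deviations are
  identified only almost surely. Measurability of \<open>E\<close> is a separate assumption because
  \<open>past\<close> is not completed by null sets.\<close>

lemma centered_cong_AE:
  assumes D: "centered t D" and E: "E \<in> borel_measurable (past (Suc t))"
    and eq: "AE \<omega> in M. D \<omega> = E \<omega>"
  shows "centered t E"
proof -
  obtain B where "AE \<omega> in M. \<bar>D \<omega>\<bar> \<le> B" using centeredD(3)[OF D] by blast
  with eq have "AE \<omega> in M. \<bar>E \<omega>\<bar> \<le> B" by eventually_elim simp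
  moreover have "expectation (\<lambda>\<omega>. Z \<omega> * E \<omega>) = 0"
    if Z: "Z \<in> borel_measurable (past t)" "AE \<omega> in M. \<bar>Z \<omega>\<bar> \<le> B" for Z B
  proof -
    have "expectation (\<lambda>\<omega>. Z \<omega> * E \<omega>) = expectation (\<lambda>\<omega>. Z \<omega> * D \<omega>)"
    proof (rule integral_cong_AE)
      show "AE \<omega> in M. Z \<omega> * E \<omega> = Z \<omega> * D \<omega>" using eq by eventually_elim simp
    qed (use past_random_variable[OF Z(1)] past_random_variable[OF E] centeredD(2)[OF D] in auto)
    with centeredD(4)[OF D Z] show ?thesis by simp
  qed
  ultimately show ?thesis using E unfolding centered_def by blast
qed

text \<open>For s < t the increment \<open>D s\<close> is itself an admissible test variable for
  \<open>D t\<close>, which gives orthogonality. The bound must be uniform in time, whereas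
  \<open>centered\<close> provides one for each time separately.\<close>

lemma centered_averages_tendsto_0:
  assumes D: "\<And>t. centered t (D t)" and B: "\<And>t. AE \<omega> in M. \<bar>D t \<omega>\<bar> \<le> B"
  shows "AE \<omega> in M. (\<lambda>N. (\<Sum>t<N. D t \<omega>) / real N) \<longlonglongrightarrow> 0"
proof (rule strong_law_bounded_orthogonal[OF centeredD(2)[OF D] B])
  fix s t :: nat assume "s < t"
  then have "D s \<in> borel_measurable (past t)"
    by (intro generated_mono[OF centeredD(1)[OF D]]) auto
  from centeredD(4)[OF D this B] show "expectation (\<lambda>\<omega>. D s \<omega> * D t \<omega>) = 0" by simp
qed

section \<open>Averaging over the drivers of one step\<close>

lemma expectation_mult_driver:
  fixes Z :: "'a \<Rightarrow> real" and \<phi> \<psi> :: "bool \<Rightarrow> real" and \<kappa> :: "nat \<Rightarrow> real"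
  assumes Z: "Z \<in> borel_measurable (generated A)" "AE \<omega> in M. \<bar>Z \<omega>\<bar> \<le> B" "A \<subseteq> UNIV \<times> {1..}"
  shows "(Request, Suc t) \<notin> A \<Longrightarrow> (\<And>x. \<bar>\<phi> x\<bar> \<le> 1) \<Longrightarrow>
      expectation (\<lambda>\<omega>. Z \<omega> * \<phi> (X (Suc t) \<omega>))
        = expectation Z * measure_pmf.expectation (bernoulli_pmf p_con) \<phi>"
    and "(Generation, Suc t) \<notin> A \<Longrightarrow> (\<And>k. \<bar>\<kappa> k\<bar> \<le> 1) \<Longrightarrow>
      expectation (\<lambda>\<omega>. Z \<omega> * \<kappa> (K (Suc t) \<omega>))
        = expectation Z * measure_pmf.expectation (binomial_pmf n p_gen) \<kappa>"
    and "(Decision, Suc t) \<notin> A \<Longrightarrow> (\<And>x. \<bar>\<psi> x\<bar> \<le> 1) \<Longrightarrow>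
      expectation (\<lambda>\<omega>. Z \<omega> * \<psi> (Q (Suc t) \<omega>))
        = expectation Z * measure_pmf.expectation (bernoulli_pmf q) \<psi>"
proof -
  assume *: "(Request, Suc t) \<notin> A" "\<And>x. \<bar>\<phi> x\<bar> \<le> 1"
  have "(\<lambda>\<omega>. \<phi> (X (Suc t) \<omega>)) \<in> borel_measurable (generated {(Request, Suc t)})"
    by (rule measurable_compose[OF drivers_measurable_generated(1)]) auto
  from expectation_mult_generated[OF Z(1,2) this, of 1] Z(3) *
  have "expectation (\<lambda>\<omega>. Z \<omega> * \<phi> (X (Suc t) \<omega>)) = expectation Z * expectation (\<lambda>\<omega>. \<phi> (X (Suc t) \<omega>))"
    by auto
  also have "expectation (\<lambda>\<omega>. \<phi> (X (Suc t) \<omega>)) = measure_pmf.expectation (bernoulli_pmf p_con) \<phi>"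
    by (subst distr_X[symmetric, of "Suc t"], simp, subst integral_distr) (auto intro: measurable_X)
  finally show "expectation (\<lambda>\<omega>. Z \<omega> * \<phi> (X (Suc t) \<omega>))
        = expectation Z * measure_pmf.expectation (bernoulli_pmf p_con) \<phi>" .
next
  assume *: "(Generation, Suc t) \<notin> A" "\<And>k. \<bar>\<kappa> k\<bar> \<le> 1"
  have "(\<lambda>\<omega>. \<kappa> (K (Suc t) \<omega>)) \<in> borel_measurable (generated {(Generation, Suc t)})"
    by (rule measurable_compose[OF drivers_measurable_generated(2)]) auto
  from expectation_mult_generated[OF Z(1,2) this, of 1] Z(3) *
  have "expectation (\<lambda>\<omega>. Z \<omega> * \<kappa> (K (Suc t) \<omega>)) = expectation Z * expectation (\<lambda>\<omega>. \<kappa> (K (Suc t) \<omega>))"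
    by auto
  also have "expectation (\<lambda>\<omega>. \<kappa> (K (Suc t) \<omega>)) = measure_pmf.expectation (binomial_pmf n p_gen) \<kappa>"
    by (subst distr_K[symmetric, of "Suc t"], simp, subst integral_distr) (auto intro: measurable_K)
  finally show "expectation (\<lambda>\<omega>. Z \<omega> * \<kappa> (K (Suc t) \<omega>))
        = expectation Z * measure_pmf.expectation (binomial_pmf n p_gen) \<kappa>" .
next
  assume *: "(Decision, Suc t) \<notin> A" "\<And>x. \<bar>\<psi> x\<bar> \<le> 1"
  have "(\<lambda>\<omega>. \<psi> (Q (Suc t) \<omega>)) \<in> borel_measurable (generated {(Decision, Suc t)})"
    by (rule measurable_compose[OF drivers_measurable_generated(3)]) auto
  from expectation_mult_generated[OF Z(1,2) this, of 1] Z(3) *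
  have "expectation (\<lambda>\<omega>. Z \<omega> * \<psi> (Q (Suc t) \<omega>)) = expectation Z * expectation (\<lambda>\<omega>. \<psi> (Q (Suc t) \<omega>))"
    by auto
  also have "expectation (\<lambda>\<omega>. \<psi> (Q (Suc t) \<omega>)) = measure_pmf.expectation (bernoulli_pmf q) \<psi>"
    by (subst distr_Q[symmetric, of "Suc t"], simp, subst integral_distr) (auto intro: measurable_Q)
  finally show "expectation (\<lambda>\<omega>. Z \<omega> * \<psi> (Q (Suc t) \<omega>))
        = expectation Z * measure_pmf.expectation (bernoulli_pmf q) \<psi>" .
qed

text \<open>Apart from the success of purification, the randomness of a step enters through such
  products. The outcome variable is kept out because it is compared with a threshold that depends on
  the state.\<close>

definition noise :: "(bool \<Rightarrow> real) \<Rightarrow> (nat \<Rightarrow> real) \<Rightarrow> (bool \<Rightarrow> real) \<Rightarrow> nat \<Rightarrow> 'a \<Rightarrow> real" where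
  "noise \<phi> \<kappa> \<psi> t \<omega> = \<phi> (X t \<omega>) * \<kappa> (K t \<omega>) * \<psi> (Q t \<omega>)"

definition noise_mean :: "(bool \<Rightarrow> real) \<Rightarrow> (nat \<Rightarrow> real) \<Rightarrow> (bool \<Rightarrow> real) \<Rightarrow> real" where
  "noise_mean \<phi> \<kappa> \<psi> = measure_pmf.expectation (bernoulli_pmf p_con) \<phi>
     * measure_pmf.expectation (binomial_pmf n p_gen) \<kappa> * measure_pmf.expectation (bernoulli_pmf q) \<psi>"

lemma abs_noise_le_1:
  assumes "\<And>x. \<bar>\<phi> x\<bar> \<le> 1" "\<And>k. \<bar>\<kappa> k\<bar> \<le> 1" "\<And>x. \<bar>\<psi> x\<bar> \<le> 1"
  shows "\<bar>noise \<phi> \<kappa> \<psi> t \<omega>\<bar> \<le> 1"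
  unfolding noise_def abs_mult using assms by (intro mult_le_one mult_nonneg_nonneg) auto

lemma measurable_noise:
  assumes "{(Request, t), (Generation, t), (Decision, t)} \<subseteq> A"
  shows "noise \<phi> \<kappa> \<psi> t \<in> borel_measurable (generated A)"
proof -
  have "(\<lambda>\<omega>. \<phi> (X t \<omega>)) \<in> borel_measurable (generated A)"
    "(\<lambda>\<omega>. \<kappa> (K t \<omega>)) \<in> borel_measurable (generated A)"
    "(\<lambda>\<omega>. \<psi> (Q t \<omega>)) \<in> borel_measurable (generated A)"
    using assms
    by (auto intro: measurable_compose[OF drivers_measurable_generated(1)]
        measurable_compose[OF drivers_measurable_generated(2)]
        measurable_compose[OF drivers_measurable_generated(3)])
  then show ?thesis unfolding noise_def by simp
qed

text \<open>The drivers are absorbed into \<open>Z\<close> one at a time. Each partial product is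
  measurable for an index set that still omits the next driver, so independence can be applied
  again.\<close>

lemma expectation_noise:
  assumes Z: "Z \<in> borel_measurable (past t)" "AE \<omega> in M. \<bar>Z \<omega>\<bar> \<le> B"
    and bounds: "\<And>x. \<bar>\<phi> x\<bar> \<le> 1" "\<And>k. \<bar>\<kappa> k\<bar> \<le> 1" "\<And>x. \<bar>\<psi> x\<bar> \<le> 1"
  shows "expectation (\<lambda>\<omega>. Z \<omega> * noise \<phi> \<kappa> \<psi> (Suc t) \<omega>) = expectation Z * noise_mean \<phi> \<kappa> \<psi>"
proof -
  let ?A = "UNIV \<times> {1..t}" and ?R = "(Request, Suc t)" and ?G = "(Generation, Suc t)"
  let ?Z1 = "\<lambda>\<omega>. Z \<omega> * \<phi> (X (Suc t) \<omega>)"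
  let ?Z2 = "\<lambda>\<omega>. ?Z1 \<omega> * \<kappa> (K (Suc t) \<omega>)"
  have "Z \<in> borel_measurable (generated (insert ?R ?A))"
    "(\<lambda>\<omega>. \<phi> (X (Suc t) \<omega>)) \<in> borel_measurable (generated (insert ?R ?A))"
    using generated_mono[OF Z(1)]
    by (auto intro: measurable_compose[OF drivers_measurable_generated(1)])
  then have Z1: "?Z1 \<in> borel_measurable (generated (insert ?R ?A))"
    by simp
  have B1: "AE \<omega> in M. \<bar>?Z1 \<omega>\<bar> \<le> B * 1"
    using bounds by (intro AE_abs_mult_le[OF Z(2)]) auto
  have "?Z1 \<in> borel_measurable (generated (insert ?G (insert ?R ?A)))"
    "(\<lambda>\<omega>. \<kappa> (K (Suc t) \<omega>)) \<in> borel_measurable (generated (insert ?G (insert ?R ?A)))"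
    by (rule generated_mono[OF Z1], blast)
      (auto intro: measurable_compose[OF drivers_measurable_generated(2)])
  then have Z2: "?Z2 \<in> borel_measurable (generated (insert ?G (insert ?R ?A)))"
    by simp
  have B2: "AE \<omega> in M. \<bar>?Z2 \<omega>\<bar> \<le> B * 1 * 1"
    using bounds by (intro AE_abs_mult_le[OF B1]) auto
  have "expectation (\<lambda>\<omega>. Z \<omega> * noise \<phi> \<kappa> \<psi> (Suc t) \<omega>) = expectation (\<lambda>\<omega>. ?Z2 \<omega> * \<psi> (Q (Suc t) \<omega>))"
    by (simp add: noise_def mult.assoc)
  also have "\<dots> = expectation ?Z2 * measure_pmf.expectation (bernoulli_pmf q) \<psi>"
    using bounds by (intro expectation_mult_driver(3)[OF Z2 B2]) auto
  also have "expectation ?Z2 = expectation ?Z1 * measure_pmf.expectation (binomial_pmf n p_gen) \<kappa>"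
    using bounds by (intro expectation_mult_driver(2)[OF Z1 B1]) auto
  also have "expectation ?Z1 = expectation Z * measure_pmf.expectation (bernoulli_pmf p_con) \<phi>"
    using bounds by (intro expectation_mult_driver(1)[OF Z]) auto
  finally show ?thesis by (simp add: noise_mean_def mult.assoc)
qed

lemma centered_noise:
  assumes Y: "Y \<in> borel_measurable (past t)" "AE \<omega> in M. \<bar>Y \<omega>\<bar> \<le> B"
    and bounds: "\<And>x. \<bar>\<phi> x\<bar> \<le> 1" "\<And>k. \<bar>\<kappa> k\<bar> \<le> 1" "\<And>x. \<bar>\<psi> x\<bar> \<le> 1"
  shows "centered t (\<lambda>\<omega>. Y \<omega> * (noise \<phi> \<kappa> \<psi> (Suc t) \<omega> - noise_mean \<phi> \<kappa> \<psi>))"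
proof -
  have N: "noise \<phi> \<kappa> \<psi> (Suc t) \<in> borel_measurable (past (Suc t))"
    by (rule measurable_noise) auto
  note NM [measurable] = past_random_variable[OF N]
  have "AE \<omega> in M. \<bar>Y \<omega> * (noise \<phi> \<kappa> \<psi> (Suc t) \<omega> - noise_mean \<phi> \<kappa> \<psi>)\<bar>
      \<le> B * (1 + \<bar>noise_mean \<phi> \<kappa> \<psi>\<bar>)"
    using abs_noise_le_1[of \<phi> \<kappa> \<psi>, OF bounds]
    by (intro AE_abs_mult_le[OF Y(2)] AE_I2 order_trans[OF abs_triangle_ineq4] add_mono) auto
  moreover have "expectation (\<lambda>\<omega>. Z \<omega> * (Y \<omega> * (noise \<phi> \<kappa> \<psi> (Suc t) \<omega> - noise_mean \<phi> \<kappa> \<psi>))) = 0"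
    if Z: "Z \<in> borel_measurable (past t)" "AE \<omega> in M. \<bar>Z \<omega>\<bar> \<le> B'" for Z B'
  proof -
    have ZY: "(\<lambda>\<omega>. Z \<omega> * Y \<omega>) \<in> borel_measurable (past t)" using Z Y by simp
    note [measurable] = past_random_variable[OF ZY]
    note B = AE_abs_mult_le[OF Z(2) Y(2)]
    have "integrable M (\<lambda>\<omega>. Z \<omega> * Y \<omega> * noise \<phi> \<kappa> \<psi> (Suc t) \<omega>)"
      using abs_noise_le_1[of \<phi> \<kappa> \<psi>, OF bounds]
      by (intro AE_bounded_integrable[where B = "B' * B * 1"] AE_abs_mult_le[OF B]) auto
    moreover have "integrable M (\<lambda>\<omega>. Z \<omega> * Y \<omega>)"
      by (intro AE_bounded_integrable[OF _ B]) measurable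
    moreover have "Z \<omega> * (Y \<omega> * (noise \<phi> \<kappa> \<psi> (Suc t) \<omega> - noise_mean \<phi> \<kappa> \<psi>))
        = Z \<omega> * Y \<omega> * noise \<phi> \<kappa> \<psi> (Suc t) \<omega> - Z \<omega> * Y \<omega> * noise_mean \<phi> \<kappa> \<psi>" for \<omega>
      by (simp add: algebra_simps)
    ultimately show ?thesis
      using expectation_noise[OF ZY B, of \<phi> \<kappa> \<psi>, OF bounds] by simp
  qed
  ultimately show ?thesis
    using Y N past_Suc[OF Y(1)] unfolding centered_def by auto
qed

text \<open>The index set \<open>?A\<close> contains the past and the other three drivers of the
  step but not the outcome. So the success indicator can first be replaced by \<open>R\<close> with
  the noise still present; afterwards \<open>R\<close> joins the past factor and the noise is
  averaged.\<close>

lemma centered_threshold: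
  assumes Y: "Y \<in> borel_measurable (past t)" "AE \<omega> in M. \<bar>Y \<omega>\<bar> \<le> B"
    and R: "R \<in> borel_measurable (past t)" "AE \<omega> in M. 0 \<le> R \<omega> \<and> R \<omega> \<le> 1"
    and bounds: "\<And>x. \<bar>\<phi> x\<bar> \<le> 1" "\<And>k. \<bar>\<kappa> k\<bar> \<le> 1" "\<And>x. \<bar>\<psi> x\<bar> \<le> 1"
  shows "centered t (\<lambda>\<omega>. Y \<omega> *
    (noise \<phi> \<kappa> \<psi> (Suc t) \<omega> * of_bool (W (Suc t) \<omega> < R \<omega>) - noise_mean \<phi> \<kappa> \<psi> * R \<omega>))"
proof -
  let ?A = "UNIV \<times> {1..t} \<union> {(Request, Suc t), (Generation, Suc t), (Decision, Suc t)}"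
  let ?N = "noise \<phi> \<kappa> \<psi> (Suc t)"
  have NA: "?N \<in> borel_measurable (generated ?A)"
    by (rule measurable_noise) auto
  have N: "?N \<in> borel_measurable (past (Suc t))"
    by (rule measurable_noise) auto
  note [measurable] = past_random_variable[OF N] past_random_variable[OF R(1)]
    past_random_variable[OF drivers_measurable_past(4)]
  have B1: "AE \<omega> in M. \<bar>?N \<omega> * of_bool (W (Suc t) \<omega> < R \<omega>)\<bar> \<le> 1"
    using abs_noise_le_1[of \<phi> \<kappa> \<psi>, OF bounds] by auto
  have RB: "AE \<omega> in M. \<bar>R \<omega>\<bar> \<le> 1" using R(2) by eventually_elim auto
  have "AE \<omega> in M. \<bar>?N \<omega> * of_bool (W (Suc t) \<omega> < R \<omega>) - noise_mean \<phi> \<kappa> \<psi> * R \<omega>\<bar>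
      \<le> 1 + \<bar>noise_mean \<phi> \<kappa> \<psi>\<bar> * 1"
    using B1 RB
  proof eventually_elim
    case (elim \<omega>)
    have "\<bar>noise_mean \<phi> \<kappa> \<psi> * R \<omega>\<bar> \<le> \<bar>noise_mean \<phi> \<kappa> \<psi>\<bar> * 1"
      unfolding abs_mult using elim by (intro mult_left_mono) auto
    with elim show ?case by linarith
  qed
  note bd = AE_abs_mult_le[OF Y(2) this]
  have "expectation (\<lambda>\<omega>. Z \<omega> * (Y \<omega> *
      (?N \<omega> * of_bool (W (Suc t) \<omega> < R \<omega>) - noise_mean \<phi> \<kappa> \<psi> * R \<omega>))) = 0"
    if Z: "Z \<in> borel_measurable (past t)" "AE \<omega> in M. \<bar>Z \<omega>\<bar> \<le> B'" for Z B'
  proof -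
    have ZY: "(\<lambda>\<omega>. Z \<omega> * Y \<omega>) \<in> borel_measurable (past t)" using Z Y by simp
    note [measurable] = past_random_variable[OF ZY]
    note B = AE_abs_mult_le[OF Z(2) Y(2)]
    have ZYR: "(\<lambda>\<omega>. Z \<omega> * Y \<omega> * R \<omega>) \<in> borel_measurable (past t)" using ZY R by simp
    note BR = AE_abs_mult_le[OF B RB]
    have "(\<lambda>\<omega>. Z \<omega> * Y \<omega>) \<in> borel_measurable (generated ?A)" "R \<in> borel_measurable (generated ?A)"
      by (rule generated_mono[OF ZY], blast, rule generated_mono[OF R(1)], blast)
    with NA have ZYN: "(\<lambda>\<omega>. Z \<omega> * Y \<omega> * ?N \<omega>) \<in> borel_measurable (generated ?A)"
      and RA: "R \<in> borel_measurable (generated ?A)" by auto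
    have A: "?A \<subseteq> UNIV \<times> {1..}" "(Outcome, Suc t) \<in> UNIV \<times> {1..}" "(Outcome, Suc t) \<notin> ?A"
      by auto
    have W: "distr M borel (case (Outcome, Suc t) of (s, t) \<Rightarrow> driving X K Q W s t)
        = uniform_measure lborel {0..1}"
      using distr_W[of "Suc t"] by (simp add: fun_eq_iff cong: distr_cong)
    have BN: "AE \<omega> in M. \<bar>Z \<omega> * Y \<omega> * ?N \<omega>\<bar> \<le> B' * B * 1"
      using abs_noise_le_1[of \<phi> \<kappa> \<psi>, OF bounds] by (intro AE_abs_mult_le[OF B]) auto
    have "expectation (\<lambda>\<omega>. Z \<omega> * Y \<omega> * ?N \<omega> * of_bool (W (Suc t) \<omega> < R \<omega>))
        = expectation (\<lambda>\<omega>. Z \<omega> * Y \<omega> * ?N \<omega> * R \<omega>)"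
      using expectation_uniform_threshold[OF ZYN BN RA R(2) A W] by simp
    also have "\<dots> = expectation (\<lambda>\<omega>. Z \<omega> * Y \<omega> * R \<omega> * ?N \<omega>)"
      by (simp add: mult_ac)
    also have "\<dots> = expectation (\<lambda>\<omega>. Z \<omega> * Y \<omega> * R \<omega>) * noise_mean \<phi> \<kappa> \<psi>"
      by (rule expectation_noise[OF ZYR BR bounds])
    finally have "expectation (\<lambda>\<omega>. Z \<omega> * Y \<omega> * (?N \<omega> * of_bool (W (Suc t) \<omega> < R \<omega>)))
        = expectation (\<lambda>\<omega>. Z \<omega> * Y \<omega> * R \<omega>) * noise_mean \<phi> \<kappa> \<psi>"
      by (simp add: mult.assoc)
    moreover have "integrable M (\<lambda>\<omega>. Z \<omega> * Y \<omega> * (?N \<omega> * of_bool (W (Suc t) \<omega> < R \<omega>)))"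
      by (intro AE_bounded_integrable[OF _ AE_abs_mult_le[OF B B1]]) measurable
    moreover have "integrable M (\<lambda>\<omega>. Z \<omega> * Y \<omega> * R \<omega>)"
      by (intro AE_bounded_integrable[OF _ BR]) measurable
    moreover have "Z \<omega> * (Y \<omega> * (?N \<omega> * of_bool (W (Suc t) \<omega> < R \<omega>) - noise_mean \<phi> \<kappa> \<psi> * R \<omega>))
        = Z \<omega> * Y \<omega> * (?N \<omega> * of_bool (W (Suc t) \<omega> < R \<omega>)) - Z \<omega> * Y \<omega> * R \<omega> * noise_mean \<phi> \<kappa> \<psi>" for \<omega>
      by (simp add: algebra_simps)
    ultimately show ?thesis by simp
  qed
  moreover have "(\<lambda>\<omega>. Y \<omega> *
      (?N \<omega> * of_bool (W (Suc t) \<omega> < R \<omega>) - noise_mean \<phi> \<kappa> \<psi> * R \<omega>)) \<in> borel_measurable (past (Suc t))"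
    using past_Suc[OF Y(1)] past_Suc[OF R(1)] N by measurable
  ultimately show ?thesis
    using bd unfolding centered_def by blast
qed

subsection \<open>Conditional means of occupation and excess\<close>

definition p_star :: real where "p_star = 1 - (1 - p_gen) ^ n"

text \<open>From an occupied memory with excess h, the next state is occupied with conditional
  probability 1 - \<alpha> + \<gamma> * h, and the conditional mean of the next fidelity minus 1/4,
  counted as 0 if the memory is empty, is \<beta> * h + \<eta>.\<close>

definition \<alpha> :: real where "\<alpha> = p_con + q * (1 - p_con) * (p_star - binomial_mean n p_gen d)"

definition \<beta> :: real where
  "\<beta> = 1 - p_con - q * (1 - p_con) * p_star + q * (1 - p_con) * binomial_mean n p_gen a"

definition \<gamma> :: real where "\<gamma> = q * (1 - p_con) * binomial_mean n p_gen c"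

definition \<eta> :: real where "\<eta> = q * (1 - p_con) * binomial_mean n p_gen b"

abbreviation idle :: "bool \<Rightarrow> real" where "idle x \<equiv> of_bool (\<not> x)"

lemma expectation_binomial_singleton:
  "measure_pmf.expectation (binomial_pmf n p_gen) (\<lambda>k. of_bool (k = j))
    = real (n choose j) * p_gen ^ j * (1 - p_gen) ^ (n - j)"
proof -
  have "(\<lambda>k. of_bool (k = j) :: real) = indicator {j}" by (auto simp: indicator_def)
  then show ?thesis using p_gen by (simp add: measure_pmf_single)
qed

lemma expectation_binomial_positive:
  "measure_pmf.expectation (binomial_pmf n p_gen) (\<lambda>k. of_bool (1 \<le> k)) = p_star"
proof -
  have "(\<lambda>k::nat. of_bool (1 \<le> k) :: real) = (\<lambda>k. 1 - of_bool (k = 0))" by auto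
  moreover have "integrable (binomial_pmf n p_gen) (\<lambda>k. of_bool (k = 0) :: real)"
    by (intro measure_pmf.integrable_const_bound[where B = 1]) auto
  ultimately show ?thesis
    using expectation_binomial_singleton[of 0] by (simp add: p_star_def)
qed

lemma noise_means:
  "noise_mean (\<lambda>_. 1) (\<lambda>k. of_bool (1 \<le> k)) (\<lambda>_. 1) = p_star"
  "noise_mean idle (\<lambda>_. 1) (\<lambda>_. 1) = 1 - p_con"
  "noise_mean of_bool (\<lambda>_. 1) (\<lambda>_. 1) = p_con"
  "noise_mean idle (\<lambda>k. of_bool (1 \<le> k)) of_bool = (1 - p_con) * p_star * q"
  "noise_mean idle (\<lambda>k. of_bool (k = j)) of_bool
    = (1 - p_con) * (real (n choose j) * p_gen ^ j * (1 - p_gen) ^ (n - j)) * q"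
  using p_con q by (simp_all only: noise_mean_def expectation_binomial_singleton expectation_binomial_positive) simp_all

text \<open>On the left \<open>k\<close> is a constant, so its coefficients are functions of the
  past; on the right stands the random index that occurs in the dynamics. Regularity gives K <= n,
  and the factor \<open>of_bool\<close> accounts for K = 0, which the sum omits.\<close>

lemma sum_noise_singletons:
  assumes "regular \<omega>"
  shows "(\<Sum>k=1..n. Y k * (noise \<phi> (\<lambda>j. of_bool (j = k)) \<psi> (Suc t) \<omega> * T k))
    = of_bool (1 \<le> K (Suc t) \<omega>) * (Y (K (Suc t) \<omega>) * (\<phi> (X (Suc t) \<omega>) * \<psi> (Q (Suc t) \<omega>) * T (K (Suc t) \<omega>)))"
proof -
  have "(\<Sum>k=1..n. Y k * (noise \<phi> (\<lambda>j. of_bool (j = k)) \<psi> (Suc t) \<omega> * T k))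
      = (\<Sum>k=1..n. if K (Suc t) \<omega> = k then Y k * (\<phi> (X (Suc t) \<omega>) * \<psi> (Q (Suc t) \<omega>) * T k) else 0)"
    by (intro sum.cong) (auto simp: noise_def)
  also have "\<dots> = of_bool (1 \<le> K (Suc t) \<omega>) * (Y (K (Suc t) \<omega>) * (\<phi> (X (Suc t) \<omega>) * \<psi> (Q (Suc t) \<omega>) * T (K (Suc t) \<omega>)))"
    using assms by (simp add: regular_def)
  finally show ?thesis .
qed

lemma sum_noise_mean_affine:
  "(\<Sum>k=1..n. noise_mean idle (\<lambda>j. of_bool (j = k)) of_bool * (f k * y + g k * z))
    = q * (1 - p_con) * (binomial_mean n p_gen f * y + binomial_mean n p_gen g * z)"
  unfolding noise_means binomial_mean_def sum_distrib_left sum_distrib_right sum.distrib[symmetric]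
  by (intro sum.cong) (simp_all add: algebra_simps)

lemma fid_Suc_empty:
  assumes "occ t \<omega> = 0"
  shows "fid (Suc t) \<omega> = (if 1 \<le> K (Suc t) \<omega> then Fnew else 0)"
  using assms by (simp add: fid_def occ_def Let_def)

lemma fid_Suc_occupied:
  assumes "occ t \<omega> = 1"
  shows "fid (Suc t) \<omega> =
    (let h = excess t \<omega>; k = K (Suc t) \<omega> in
     if X (Suc t) \<omega> then 0
     else if 1 \<le> k \<and> Q (Suc t) \<omega>
     then if W (Suc t) \<omega> < c k * h + d k then 1/4 + (a k * h + b k) / (c k * h + d k) else 0
     else h + 1/4)"
proof -
  have "fid t \<omega> > 0" using assms by (simp add: occ_def split: if_splits)
  moreover from this have "decay \<Gamma> (fid t \<omega>) = excess t \<omega> + 1/4"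
    by (simp add: decay_def excess_def occ_def)
  ultimately show ?thesis
    by (simp add: fid_def Let_def succ_prob_def jump_def)
qed

lemma policy_at_excess:
  assumes "regular \<omega>" "k \<in> {1..n}"
  shows "0 \<le> c k * excess t \<omega> + d k" "c k * excess t \<omega> + d k \<le> 1" "0 \<le> a k * excess t \<omega> + b k"
    "a k * excess t \<omega> + b k \<le> 3/4 * (c k * excess t \<omega> + d k)"
proof -
  have "excess t \<omega> \<le> 3/4" using excess_bounds[OF assms(1), of t] occ_cases[of t \<omega>] by auto
  from physical_policyD[OF physical assms(2) excess_bounds(1)[OF assms(1)] this]
  show "0 \<le> c k * excess t \<omega> + d k" "c k * excess t \<omega> + d k \<le> 1" "0 \<le> a k * excess t \<omega> + b k"
    "a k * excess t \<omega> + b k \<le> 3/4 * (c k * excess t \<omega> + d k)" by blast+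
qed

text \<open>Inclusion and exclusion: an occupied memory survives if no request arrives, minus the
  cases in which purification is attempted, plus the attempts that succeed. No case distinction on
  the reasons for not purifying is then needed.\<close>

lemma occ_Suc:
  assumes reg: "regular \<omega>"
  shows "occ (Suc t) \<omega> =
    (1 - occ t \<omega>) * noise (\<lambda>_. 1) (\<lambda>k. of_bool (1 \<le> k)) (\<lambda>_. 1) (Suc t) \<omega>
    + occ t \<omega> * noise idle (\<lambda>_. 1) (\<lambda>_. 1) (Suc t) \<omega>
    + (- occ t \<omega>) * noise idle (\<lambda>k. of_bool (1 \<le> k)) of_bool (Suc t) \<omega>
    + (\<Sum>k=1..n. occ t \<omega> * (noise idle (\<lambda>j. of_bool (j = k)) of_bool (Suc t) \<omega>
        * of_bool (W (Suc t) \<omega> < c k * excess t \<omega> + d k)))"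
proof -
  have KW: "K (Suc t) \<omega> \<le> n" "0 \<le> W (Suc t) \<omega>" using reg by (auto simp: regular_def)
  consider "occ t \<omega> = 0" | "occ t \<omega> = 1" using occ_cases by blast
  then show ?thesis
  proof cases
    case 1
    then show ?thesis
      using fid_Suc_empty[OF 1] Fnew by (simp add: occ_def[of "Suc t"] noise_def)
  next
    case 2
    let ?k = "K (Suc t) \<omega>"
    \<comment> \<open>A purified link must count as occupying the memory. The quotient is
      nonnegative, also for a zero denominator, where it is 0.\<close>
    have "0 < 1/4 + (a ?k * excess t \<omega> + b ?k) / (c ?k * excess t \<omega> + d ?k)" if "1 \<le> ?k"
      using policy_at_excess[OF reg, of ?k t] that KW by (intro add_pos_nonneg divide_nonneg_nonneg) auto
    moreover have "0 < excess t \<omega> + 1/4" using excess_bounds(1)[OF reg, of t] by simp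
    ultimately show ?thesis
      unfolding sum_noise_singletons[OF reg]
      using fid_Suc_occupied[OF 2] 2 by (auto simp: occ_def[of "Suc t"] noise_def Let_def)
  qed
qed

text \<open>The decomposition of \<open>occ_Suc\<close>, each term weighted by the resulting
  fidelity minus 1/4. The factor \<open>occ t \<omega>\<close> in the sum is essential because
  \<open>b k\<close> contributes even at excess 0.\<close>

lemma excess_Suc:
  assumes reg: "regular \<omega>"
  shows "exp \<Gamma> * excess (Suc t) \<omega> =
    ((Fnew - 1/4) * (1 - occ t \<omega>)) * noise (\<lambda>_. 1) (\<lambda>k. of_bool (1 \<le> k)) (\<lambda>_. 1) (Suc t) \<omega>
    + excess t \<omega> * noise idle (\<lambda>_. 1) (\<lambda>_. 1) (Suc t) \<omega>
    + (- excess t \<omega>) * noise idle (\<lambda>k. of_bool (1 \<le> k)) of_bool (Suc t) \<omega>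
    + (\<Sum>k=1..n. (occ t \<omega> * ((a k * excess t \<omega> + b k) / (c k * excess t \<omega> + d k)))
        * (noise idle (\<lambda>j. of_bool (j = k)) of_bool (Suc t) \<omega>
        * of_bool (W (Suc t) \<omega> < c k * excess t \<omega> + d k)))"
proof -
  have KW: "K (Suc t) \<omega> \<le> n" "0 \<le> W (Suc t) \<omega>" using reg by (auto simp: regular_def)
  have lhs: "exp \<Gamma> * excess (Suc t) \<omega> = (fid (Suc t) \<omega> - 1/4) * occ (Suc t) \<omega>"
    by (simp add: excess_def exp_minus field_simps)
  consider "occ t \<omega> = 0" | "occ t \<omega> = 1" using occ_cases by blast
  then show ?thesis
  proof cases
    case 1
    then have "excess t \<omega> = 0" by (simp add: excess_def)
    then show ?thesis
      unfolding lhs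
      using fid_Suc_empty[OF 1] Fnew 1 by (simp add: occ_def[of "Suc t"] noise_def)
  next
    case 2
    let ?k = "K (Suc t) \<omega>"
    have "0 < 1/4 + (a ?k * excess t \<omega> + b ?k) / (c ?k * excess t \<omega> + d ?k)" if "1 \<le> ?k"
      using policy_at_excess[OF reg, of ?k t] that KW by (intro add_pos_nonneg divide_nonneg_nonneg) auto
    moreover have "0 < excess t \<omega> + 1/4" using excess_bounds(1)[OF reg, of t] by simp
    ultimately show ?thesis
      unfolding lhs sum_noise_singletons[OF reg]
      using fid_Suc_occupied[OF 2] 2 by (auto simp: occ_def[of "Suc t"] noise_def Let_def)
  qed
qed

lemma AE_occ_le: "AE \<omega> in M. \<bar>occ t \<omega>\<bar> \<le> 1"
  by (simp add: occ_def)

lemma AE_excess_le: "AE \<omega> in M. \<bar>excess t \<omega>\<bar> \<le> 1"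
  using AE_regular by eventually_elim (rule excess_bounds)

lemma AE_policy_at_excess:
  assumes "k \<in> {1..n}"
  shows "AE \<omega> in M. 0 \<le> c k * excess t \<omega> + d k \<and> c k * excess t \<omega> + d k \<le> 1"
  using AE_regular by eventually_elim (use assms policy_at_excess in blast)

lemma measurable_occ_Suc [measurable]: "occ t \<in> borel_measurable (past (Suc t))"
  and measurable_excess_Suc [measurable]: "excess t \<in> borel_measurable (past (Suc t))"
  by (rule past_Suc, measurable)+

text \<open>Deviations of the next state from its conditional mean, which is affine in the present
  \<open>occ\<close> and \<open>excess\<close>: in the purification term the success probability cancels the denominator
  of the jump function.\<close>

definition occ_dev :: "nat \<Rightarrow> 'a \<Rightarrow> real" where
  "occ_dev t \<omega> = occ (Suc t) \<omega> - (p_star * (1 - occ t \<omega>) + (1 - \<alpha>) * occ t \<omega> + \<gamma> * excess t \<omega>)"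

definition excess_dev :: "nat \<Rightarrow> 'a \<Rightarrow> real" where
  "excess_dev t \<omega> = exp \<Gamma> * excess (Suc t) \<omega>
     - ((Fnew - 1/4) * p_star * (1 - occ t \<omega>) + \<beta> * excess t \<omega> + \<eta> * occ t \<omega>)"

lemma centered_occ_dev: "centered t (occ_dev t)"
proof (rule centered_cong_AE)
  let ?\<nu> = "\<lambda>\<phi> \<kappa> \<psi> \<omega>. noise \<phi> \<kappa> \<psi> (Suc t) \<omega>"
  let ?g = "\<lambda>k::nat. of_bool (1 \<le> k) :: real" and ?e = "\<lambda>k j::nat. of_bool (j = k) :: real"
  let ?one = "\<lambda>_. 1 :: real" and ?Q = "of_bool :: bool \<Rightarrow> real"
  let ?T = "\<lambda>\<omega>. (1 - occ t \<omega>) * (?\<nu> ?one ?g ?one \<omega> - noise_mean ?one ?g ?one)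
     + occ t \<omega> * (?\<nu> idle ?one ?one \<omega> - noise_mean idle ?one ?one)
     + (- occ t \<omega>) * (?\<nu> idle ?g ?Q \<omega> - noise_mean idle ?g ?Q)
     + (\<Sum>k=1..n. occ t \<omega> * (?\<nu> idle (?e k) ?Q \<omega> * of_bool (W (Suc t) \<omega> < c k * excess t \<omega> + d k)
          - noise_mean idle (?e k) ?Q * (c k * excess t \<omega> + d k)))"
  have meas: "(\<lambda>\<omega>. 1 - occ t \<omega>) \<in> borel_measurable (past t)" "occ t \<in> borel_measurable (past t)"
    "(\<lambda>\<omega>. - occ t \<omega>) \<in> borel_measurable (past t)"
    "(\<lambda>\<omega>. c k * excess t \<omega> + d k) \<in> borel_measurable (past t)" for k
    by measurable
  have "AE \<omega> in M. \<bar>1 - occ t \<omega>\<bar> \<le> 1" "AE \<omega> in M. \<bar>- occ t \<omega>\<bar> \<le> 1"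
    by (auto simp: occ_def)
  then show "centered t ?T"
    using meas AE_occ_le[of t]
    by (intro centered_add centered_sum centered_noise centered_threshold[OF _ AE_occ_le _ AE_policy_at_excess])
      auto
  show "occ_dev t \<in> borel_measurable (past (Suc t))"
    unfolding occ_dev_def by measurable
  show "AE \<omega> in M. ?T \<omega> = occ_dev t \<omega>"
    using AE_regular
  proof eventually_elim
    case (elim \<omega>)
    \<comment> \<open>\<open>excess\<close> already contains the factor \<open>occ\<close>, which
      takes only the values 0 and 1.\<close>
    have oh: "occ t \<omega> * excess t \<omega> = excess t \<omega>" by (simp add: excess_def occ_def)
    have "(\<Sum>k=1..n. occ t \<omega> * (noise_mean idle (?e k) ?Q * (c k * excess t \<omega> + d k)))
        = (\<Sum>k=1..n. noise_mean idle (?e k) ?Q * (c k * (occ t \<omega> * excess t \<omega>) + d k * occ t \<omega>))"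
      by (intro sum.cong) (simp_all add: algebra_simps)
    also have "\<dots> = \<gamma> * excess t \<omega> + q * (1 - p_con) * binomial_mean n p_gen d * occ t \<omega>"
      unfolding sum_noise_mean_affine oh by (simp add: \<gamma>_def algebra_simps)
    finally show ?case
      unfolding occ_dev_def occ_Suc[OF elim] right_diff_distrib sum_subtractf noise_means(1,2,4) \<alpha>_def
      by (simp add: algebra_simps)
  qed
qed

lemma centered_excess_dev: "centered t (excess_dev t)"
proof (rule centered_cong_AE)
  let ?\<nu> = "\<lambda>\<phi> \<kappa> \<psi> \<omega>. noise \<phi> \<kappa> \<psi> (Suc t) \<omega>"
  let ?g = "\<lambda>k::nat. of_bool (1 \<le> k) :: real" and ?e = "\<lambda>k j::nat. of_bool (j = k) :: real"
  let ?one = "\<lambda>_. 1 :: real" and ?Q = "of_bool :: bool \<Rightarrow> real"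
  let ?J = "\<lambda>k \<omega>. occ t \<omega> * ((a k * excess t \<omega> + b k) / (c k * excess t \<omega> + d k))"
  let ?T = "\<lambda>\<omega>. ((Fnew - 1/4) * (1 - occ t \<omega>)) * (?\<nu> ?one ?g ?one \<omega> - noise_mean ?one ?g ?one)
     + excess t \<omega> * (?\<nu> idle ?one ?one \<omega> - noise_mean idle ?one ?one)
     + (- excess t \<omega>) * (?\<nu> idle ?g ?Q \<omega> - noise_mean idle ?g ?Q)
     + (\<Sum>k=1..n. ?J k \<omega> * (?\<nu> idle (?e k) ?Q \<omega> * of_bool (W (Suc t) \<omega> < c k * excess t \<omega> + d k)
          - noise_mean idle (?e k) ?Q * (c k * excess t \<omega> + d k)))"
  have meas: "(\<lambda>\<omega>. (Fnew - 1/4) * (1 - occ t \<omega>)) \<in> borel_measurable (past t)"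
    "excess t \<in> borel_measurable (past t)" "(\<lambda>\<omega>. - excess t \<omega>) \<in> borel_measurable (past t)"
    "?J k \<in> borel_measurable (past t)"
    "(\<lambda>\<omega>. c k * excess t \<omega> + d k) \<in> borel_measurable (past t)" for k
    by measurable
  have 1: "AE \<omega> in M. \<bar>(Fnew - 1/4) * (1 - occ t \<omega>)\<bar> \<le> 1" using Fnew by (auto simp: occ_def)
  have 2: "AE \<omega> in M. \<bar>- excess t \<omega>\<bar> \<le> 1" using AE_excess_le[of t] by simp
  have 3: "AE \<omega> in M. \<bar>?J k \<omega>\<bar> \<le> 3/4" if "k \<in> {1..n}" for k
    using AE_regular
  proof eventually_elim
    case (elim \<omega>)
    have "\<bar>(a k * excess t \<omega> + b k) / (c k * excess t \<omega> + d k)\<bar> \<le> 3/4"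
      using policy_at_excess[OF elim that, of t]
      by (cases "c k * excess t \<omega> + d k = 0") (auto simp: divide_le_eq)
    then show ?case using occ_cases[of t \<omega>] by auto
  qed
  have "centered t (\<lambda>\<omega>. ((Fnew - 1/4) * (1 - occ t \<omega>)) * (?\<nu> ?one ?g ?one \<omega> - noise_mean ?one ?g ?one))"
    by (rule centered_noise[OF meas(1) 1]) auto
  moreover have "centered t (\<lambda>\<omega>. excess t \<omega> * (?\<nu> idle ?one ?one \<omega> - noise_mean idle ?one ?one))"
    by (rule centered_noise[OF meas(2) AE_excess_le]) auto
  moreover have "centered t (\<lambda>\<omega>. (- excess t \<omega>) * (?\<nu> idle ?g ?Q \<omega> - noise_mean idle ?g ?Q))"
    by (rule centered_noise[OF meas(3) 2]) auto
  moreover have "centered t (\<lambda>\<omega>. \<Sum>k=1..n. ?J k \<omega> * (?\<nu> idle (?e k) ?Q \<omega>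
      * of_bool (W (Suc t) \<omega> < c k * excess t \<omega> + d k) - noise_mean idle (?e k) ?Q * (c k * excess t \<omega> + d k)))"
    by (rule centered_sum, rule centered_threshold[OF meas(4) 3 meas(5) AE_policy_at_excess]) auto
  ultimately show "centered t ?T"
    by (intro centered_add)
  show "excess_dev t \<in> borel_measurable (past (Suc t))"
    unfolding excess_dev_def by measurable
  show "AE \<omega> in M. ?T \<omega> = excess_dev t \<omega>"
    using AE_regular
  proof eventually_elim
    case (elim \<omega>)
    have oh: "occ t \<omega> * excess t \<omega> = excess t \<omega>" by (simp add: excess_def occ_def)
    have "(\<Sum>k=1..n. ?J k \<omega> * (noise_mean idle (?e k) ?Q * (c k * excess t \<omega> + d k)))
        = (\<Sum>k=1..n. noise_mean idle (?e k) ?Q * (a k * (occ t \<omega> * excess t \<omega>) + b k * occ t \<omega>))"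
    proof (intro sum.cong refl)
      fix k assume "k \<in> {1..n}"
      note P = policy_at_excess[OF elim this, of t]
      \<comment> \<open>Cancellation survives a zero denominator: the numerator lies between 0 and
        3/4 times the denominator, so it vanishes too.\<close>
      have "(a k * excess t \<omega> + b k) / (c k * excess t \<omega> + d k) * (c k * excess t \<omega> + d k)
          = a k * excess t \<omega> + b k"
        using P by (cases "c k * excess t \<omega> + d k = 0") auto
      moreover have "?J k \<omega> * (noise_mean idle (?e k) ?Q * (c k * excess t \<omega> + d k))
          = noise_mean idle (?e k) ?Q * occ t \<omega>
            * ((a k * excess t \<omega> + b k) / (c k * excess t \<omega> + d k) * (c k * excess t \<omega> + d k))"
        by (simp only: mult_ac)
      ultimately show "?J k \<omega> * (noise_mean idle (?e k) ?Q * (c k * excess t \<omega> + d k))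
          = noise_mean idle (?e k) ?Q * (a k * (occ t \<omega> * excess t \<omega>) + b k * occ t \<omega>)"
        by (simp only:) (simp add: algebra_simps)
    qed
    also have "\<dots> = q * (1 - p_con) * binomial_mean n p_gen a * excess t \<omega> + \<eta> * occ t \<omega>"
      unfolding sum_noise_mean_affine oh by (simp add: \<eta>_def algebra_simps)
    finally have mean: "(\<Sum>k=1..n. ?J k \<omega> * (noise_mean idle (?e k) ?Q * (c k * excess t \<omega> + d k)))
        = q * (1 - p_con) * binomial_mean n p_gen a * excess t \<omega> + \<eta> * occ t \<omega>" .
    define S where "S = (\<Sum>k=1..n. ?J k \<omega> * (?\<nu> idle (?e k) ?Q \<omega> * of_bool (W (Suc t) \<omega> < c k * excess t \<omega> + d k)))"
    have "(\<Sum>k=1..n. ?J k \<omega> * (?\<nu> idle (?e k) ?Q \<omega> * of_bool (W (Suc t) \<omega> < c k * excess t \<omega> + d k)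
          - noise_mean idle (?e k) ?Q * (c k * excess t \<omega> + d k)))
        = S - (\<Sum>k=1..n. ?J k \<omega> * (noise_mean idle (?e k) ?Q * (c k * excess t \<omega> + d k)))"
      by (simp only: S_def sum_subtractf[symmetric] right_diff_distrib)
    note this[unfolded mean]
    then show ?case
      unfolding excess_dev_def excess_Suc[OF elim] S_def[symmetric] noise_means(1,2,4) \<beta>_def
      by (simp only:) (simp add: algebra_simps)
  qed
qed

section \<open>Limits of time averages along almost every path\<close>

lemma AE_abs_affine_le:
  assumes "AE \<omega> in M. \<bar>Z \<omega>\<bar> \<le> B"
  shows "AE \<omega> in M. \<bar>Z \<omega> - (u * (1 - occ t \<omega>) + v * excess t \<omega> + w * occ t \<omega>)\<bar>
    \<le> B + \<bar>u\<bar> + \<bar>v\<bar> + \<bar>w\<bar>"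
  using assms AE_excess_le[of t]
proof eventually_elim
  case (elim \<omega>)
  have "\<bar>v * excess t \<omega>\<bar> \<le> \<bar>v\<bar>" using elim(2) by (simp add: abs_mult mult_left_le)
  moreover have "\<bar>u * (1 - occ t \<omega>)\<bar> \<le> \<bar>u\<bar>" "\<bar>w * occ t \<omega>\<bar> \<le> \<bar>w\<bar>"
    using occ_cases[of t \<omega>] by auto
  ultimately show ?case using elim(1) by linarith
qed

text \<open>In the last two limits the state at time t is determined by the past, while the request
  at time \<open>Suc t\<close> is independent of it, so requests sample the state without
  bias.\<close>

lemma AE_averages_tendsto_0:
  "AE \<omega> in M. (\<lambda>N. (\<Sum>t<N. occ_dev t \<omega>) / real N) \<longlonglongrightarrow> 0"
  "AE \<omega> in M. (\<lambda>N. (\<Sum>t<N. excess_dev t \<omega>) / real N) \<longlonglongrightarrow> 0"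
  "AE \<omega> in M. (\<lambda>N. (\<Sum>t<N. occ t \<omega> * (of_bool (X (Suc t) \<omega>) - p_con)) / real N) \<longlonglongrightarrow> 0"
  "AE \<omega> in M. (\<lambda>N. (\<Sum>t<N. excess t \<omega> * (of_bool (X (Suc t) \<omega>) - p_con)) / real N) \<longlonglongrightarrow> 0"
proof -
  have "AE \<omega> in M. \<bar>occ_dev t \<omega>\<bar> \<le> 1 + \<bar>p_star\<bar> + \<bar>\<gamma>\<bar> + \<bar>1 - \<alpha>\<bar>" for t
    using AE_abs_affine_le[OF AE_occ_le[of "Suc t"], of p_star t \<gamma> "1 - \<alpha>"]
    by (simp add: occ_dev_def algebra_simps)
  from centered_averages_tendsto_0[OF centered_occ_dev this]
  show "AE \<omega> in M. (\<lambda>N. (\<Sum>t<N. occ_dev t \<omega>) / real N) \<longlonglongrightarrow> 0" .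
  have "AE \<omega> in M. \<bar>exp \<Gamma> * excess (Suc t) \<omega>\<bar> \<le> exp \<Gamma> * 1" for t
    using AE_excess_le[of "Suc t"] by eventually_elim (simp add: abs_mult)
  from AE_abs_affine_le[OF this]
  have "AE \<omega> in M. \<bar>excess_dev t \<omega>\<bar> \<le> exp \<Gamma> * 1 + \<bar>(Fnew - 1/4) * p_star\<bar> + \<bar>\<beta>\<bar> + \<bar>\<eta>\<bar>" for t
    unfolding excess_dev_def .
  from centered_averages_tendsto_0[OF centered_excess_dev this]
  show "AE \<omega> in M. (\<lambda>N. (\<Sum>t<N. excess_dev t \<omega>) / real N) \<longlonglongrightarrow> 0" .
  have req: "noise of_bool (\<lambda>_. 1) (\<lambda>_. 1) (Suc t) \<omega> = of_bool (X (Suc t) \<omega>)" for t \<omega>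
    by (simp add: noise_def)
  have le: "\<bar>of_bool (X (Suc t) \<omega>) - p_con\<bar> \<le> 1" for t \<omega>
    using p_con by auto
  have "centered t (\<lambda>\<omega>. occ t \<omega> * (of_bool (X (Suc t) \<omega>) - p_con))" for t
    using centered_noise[OF measurable_occ AE_occ_le, of of_bool "\<lambda>_. 1" "\<lambda>_. 1"]
    by (simp add: req noise_means)
  moreover have "AE \<omega> in M. \<bar>occ t \<omega> * (of_bool (X (Suc t) \<omega>) - p_con)\<bar> \<le> 1 * 1" for t
    by (intro AE_abs_mult_le AE_occ_le AE_I2 le)
  ultimately show "AE \<omega> in M. (\<lambda>N. (\<Sum>t<N. occ t \<omega> * (of_bool (X (Suc t) \<omega>) - p_con)) / real N) \<longlonglongrightarrow> 0"
    by (rule centered_averages_tendsto_0)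
  have "centered t (\<lambda>\<omega>. excess t \<omega> * (of_bool (X (Suc t) \<omega>) - p_con))" for t
    using centered_noise[OF measurable_excess AE_excess_le, of of_bool "\<lambda>_. 1" "\<lambda>_. 1"]
    by (simp add: req noise_means)
  moreover have "AE \<omega> in M. \<bar>excess t \<omega> * (of_bool (X (Suc t) \<omega>) - p_con)\<bar> \<le> 1 * 1" for t
    by (intro AE_abs_mult_le AE_excess_le AE_I2 le)
  ultimately show "AE \<omega> in M. (\<lambda>N. (\<Sum>t<N. excess t \<omega> * (of_bool (X (Suc t) \<omega>) - p_con)) / real N) \<longlonglongrightarrow> 0"
    by (rule centered_averages_tendsto_0)
qed

lemma p_star_pos: "p_star > 0"
proof -
  have "(1 - p_gen) ^ n \<le> (1 - p_gen) ^ 1"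
    using n p_gen by (intro power_decreasing) auto
  then show ?thesis using p_gen by (simp add: p_star_def)
qed

text \<open>The terms with factor q * (1 - p_con) form a binomial average over k >= 1 of 1 - a_k + f
  * c_k, nonnegative by physicality. Strict positivity comes from p_con > 0 and exp \<Gamma> >=
  1.\<close>

lemma denominator_pos: "exp \<Gamma> - \<beta> + (Fnew - 1/4) * \<gamma> > 0"
proof -
  define f where "f = Fnew - 1/4"
  have f: "0 \<le> f" "f \<le> 3/4" using Fnew by (auto simp: f_def)
  define \<pi> where "\<pi> k = real (n choose k) * (1 - p_gen) ^ (n - k) * p_gen ^ k" for k
  have \<pi>: "\<pi> k \<ge> 0" for k using p_gen by (simp add: \<pi>_def)
  have "(\<Sum>k\<le>n. \<pi> k) = 1"
    using binomial_ring[of p_gen "1 - p_gen" n] by (simp add: \<pi>_def mult_ac)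
  moreover have "(\<Sum>k\<le>n. \<pi> k) = \<pi> 0 + (\<Sum>k=1..n. \<pi> k)"
    by (subst sum.atMost_shift) (simp add: sum.atLeast1_atMost_eq lessThan_Suc_atMost)
  ultimately have "p_star = (\<Sum>k=1..n. \<pi> k)" by (simp add: p_star_def \<pi>_def)
  then have "p_star - binomial_mean n p_gen a + f * binomial_mean n p_gen c
      = (\<Sum>k=1..n. \<pi> k * (1 - a k + f * c k))"
    by (simp add: binomial_mean_def \<pi>_def[symmetric] mult.assoc sum_distrib_left sum_subtractf[symmetric]
        sum.distrib[symmetric] algebra_simps) (simp add: \<pi>_def algebra_simps)
  also have "\<dots> \<ge> 0"
  proof (intro sum_nonneg mult_nonneg_nonneg \<pi>)
    fix k assume k: "k \<in> {1..n}"
    note P0 = physical_policyD[OF physical k, of 0] and P1 = physical_policyD[OF physical k, of "3/4"]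
    show "0 \<le> 1 - a k + f * c k"
    \<comment> \<open>If c_k >= 0, physicality at y = 3/4 together with b_k >= 0 gives a_k <= 1. If
      c_k < 0, the worst case is f = 3/4, where b_k >= 0 and d_k <= 1 give a_k <= 1 + 3/4 * c_k; the
      last two bounds need y = 0.\<close>
    proof (cases "c k \<ge> 0")
      case True
      then show ?thesis using P0 P1 f by (simp add: add_nonneg_nonneg)
    next
      case False
      then have "3/4 * c k \<le> f * c k" using f by (simp add: mult_right_mono_neg)
      then show ?thesis using P0 P1 by simp
    qed
  qed
  finally have "q * (1 - p_con) * (p_star - binomial_mean n p_gen a + f * binomial_mean n p_gen c) \<ge> 0"
    using q p_con by simp
  moreover have "exp \<Gamma> \<ge> 1" using \<Gamma> by simp
  moreover have "exp \<Gamma> - \<beta> + f * \<gamma> = (exp \<Gamma> - 1) + p_con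
      + q * (1 - p_con) * (p_star - binomial_mean n p_gen a + f * binomial_mean n p_gen c)"
    by (simp add: \<beta>_def \<gamma>_def algebra_simps)
  ultimately show ?thesis
    using p_con unfolding f_def by linarith
qed

definition occ_avg :: "'a \<Rightarrow> nat \<Rightarrow> real" where
  "occ_avg \<omega> N = (\<Sum>t<N. occ t \<omega>) / real N"

definition excess_avg :: "'a \<Rightarrow> nat \<Rightarrow> real" where
  "excess_avg \<omega> N = (\<Sum>t<N. excess t \<omega>) / real N"

definition req_occ_avg :: "'a \<Rightarrow> nat \<Rightarrow> real" where
  "req_occ_avg \<omega> N = (\<Sum>t<N. of_bool (X (Suc t) \<omega>) * occ t \<omega>) / real N"

definition req_excess_avg :: "'a \<Rightarrow> nat \<Rightarrow> real" where
  "req_excess_avg \<omega> N = (\<Sum>t<N. of_bool (X (Suc t) \<omega>) * excess t \<omega>) / real N"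

lemma AE_request_averages:
  "AE \<omega> in M. (\<exists>\<delta>>0. \<forall>\<^sub>F N in sequentially. \<delta> \<le> req_occ_avg \<omega> N) \<and>
     (\<lambda>N. req_excess_avg \<omega> N / req_occ_avg \<omega> N)
       \<longlonglongrightarrow> (\<eta> + (Fnew - 1/4) * \<alpha>) / (exp \<Gamma> - \<beta> + (Fnew - 1/4) * \<gamma>)"
  using AE_regular AE_averages_tendsto_0
proof eventually_elim
  case (elim \<omega>)
  note reg = elim(1)
  have shift: "(\<Sum>t<N. u (Suc t)) = (\<Sum>t<N. u t) + (u N - u 0)" for u :: "nat \<Rightarrow> real" and N
    by (induction N) auto
  have bo: "\<bar>occ t \<omega>\<bar> \<le> 1" for t by (simp add: occ_def)
  note be = excess_bounds[OF reg]
  \<comment> \<open>Summing the definition of \<open>occ_dev\<close> telescopes: the defect in the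
    first stationarity equation is the boundary term minus the average deviation.\<close>
  have lim1: "(\<lambda>N. (occ N \<omega> - occ 0 \<omega>) / real N - (\<Sum>t<N. occ_dev t \<omega>) / real N) \<longlonglongrightarrow> 0 - 0"
    by (intro tendsto_diff tendsto_boundary_term[of "\<lambda>t. occ t \<omega>" 1] elim bo)
  have ev1: "\<forall>\<^sub>F N in sequentially. (occ N \<omega> - occ 0 \<omega>) / real N - (\<Sum>t<N. occ_dev t \<omega>) / real N
      = p_star * (1 - occ_avg \<omega> N) - \<alpha> * occ_avg \<omega> N + \<gamma> * excess_avg \<omega> N"
    using eventually_gt_at_top[of 0]
  proof eventually_elim
    case (elim N)
    have S: "(\<Sum>t<N. occ t \<omega>) = real N * occ_avg \<omega> N" "(\<Sum>t<N. excess t \<omega>) = real N * excess_avg \<omega> N"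
      using elim by (simp_all add: occ_avg_def excess_avg_def)
    have "(\<Sum>t<N. occ_dev t \<omega>) = (occ N \<omega> - occ 0 \<omega>)
        - real N * (p_star * (1 - occ_avg \<omega> N) - \<alpha> * occ_avg \<omega> N + \<gamma> * excess_avg \<omega> N)"
      unfolding occ_dev_def sum_subtractf sum.distrib sum_distrib_left[symmetric] shift[of "\<lambda>t. occ t \<omega>"] S
      by (simp add: algebra_simps)
    with elim show ?case by (simp add: diff_divide_distrib)
  qed
  have eq1: "(\<lambda>N. p_star * (1 - occ_avg \<omega> N) - \<alpha> * occ_avg \<omega> N + \<gamma> * excess_avg \<omega> N) \<longlonglongrightarrow> 0"
    using Lim_transform_eventually[OF lim1 ev1] by (simp only: diff_0_right)
  have lim2: "(\<lambda>N. (\<Sum>t<N. excess_dev t \<omega>) / real N - exp \<Gamma> * ((excess N \<omega> - excess 0 \<omega>) / real N)) \<longlonglongrightarrow> 0 - exp \<Gamma> * 0"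
    by (intro tendsto_intros tendsto_boundary_term[of "\<lambda>t. excess t \<omega>" 1] elim be)
  have ev2: "\<forall>\<^sub>F N in sequentially. (\<Sum>t<N. excess_dev t \<omega>) / real N - exp \<Gamma> * ((excess N \<omega> - excess 0 \<omega>) / real N)
      = exp \<Gamma> * excess_avg \<omega> N
        - ((Fnew - 1/4) * p_star * (1 - occ_avg \<omega> N) + \<beta> * excess_avg \<omega> N + \<eta> * occ_avg \<omega> N)"
    using eventually_gt_at_top[of 0]
  proof eventually_elim
    case (elim N)
    define f where "f = Fnew - 1/4"
    have S: "(\<Sum>t<N. occ t \<omega>) = real N * occ_avg \<omega> N" "(\<Sum>t<N. excess t \<omega>) = real N * excess_avg \<omega> N"
      using elim by (simp_all add: occ_avg_def excess_avg_def)
    have "(\<Sum>t<N. excess_dev t \<omega>) = exp \<Gamma> * (excess N \<omega> - excess 0 \<omega>)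
        + real N * (exp \<Gamma> * excess_avg \<omega> N
          - (f * p_star * (1 - occ_avg \<omega> N) + \<beta> * excess_avg \<omega> N + \<eta> * occ_avg \<omega> N))"
      unfolding excess_dev_def f_def[symmetric] sum_subtractf sum.distrib sum_distrib_left[symmetric]
        shift[of "\<lambda>t. excess t \<omega>"] S
      by (simp add: algebra_simps)
    with elim show ?case
      unfolding f_def[symmetric] by (simp add: add_divide_distrib)
  qed
  have eq2: "(\<lambda>N. exp \<Gamma> * excess_avg \<omega> N
      - ((Fnew - 1/4) * p_star * (1 - occ_avg \<omega> N) + \<beta> * excess_avg \<omega> N + \<eta> * occ_avg \<omega> N)) \<longlonglongrightarrow> 0"
    using Lim_transform_eventually[OF lim2 ev2] by (simp only: diff_0_right mult_zero_right)
  have req: "(\<Sum>t<N. u t * (of_bool (X (Suc t) \<omega>) - p_con)) / real N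
      = (\<Sum>t<N. of_bool (X (Suc t) \<omega>) * u t) / real N - p_con * ((\<Sum>t<N. u t) / real N)"
    for u :: "nat \<Rightarrow> real" and N
  proof -
    have "(\<Sum>t<N. u t * (of_bool (X (Suc t) \<omega>) - p_con))
        = (\<Sum>t<N. of_bool (X (Suc t) \<omega>) * u t) - p_con * (\<Sum>t<N. u t)"
      unfolding sum_distrib_left sum_subtractf[symmetric]
      by (intro sum.cong) (simp_all add: right_diff_distrib mult.commute)
    then show ?thesis by (simp add: diff_divide_distrib)
  qed
  note C = elim(4)[unfolded req, folded req_occ_avg_def occ_avg_def]
  note G = elim(5)[unfolded req, folded req_excess_avg_def excess_avg_def]
  have H: "0 \<le> excess_avg \<omega> N" for N
    using be by (simp add: excess_avg_def sum_nonneg)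
  have "excess t \<omega> \<le> occ t \<omega>" for t
    using be(2)[of t] occ_cases[of t \<omega>] by auto
  then have HO: "excess_avg \<omega> N \<le> occ_avg \<omega> N" for N
    unfolding excess_avg_def occ_avg_def by (intro divide_right_mono sum_mono) auto
  note * = stationary_averages_ratio[OF p_star_pos p_con(1) denominator_pos H HO eq1 eq2 C G]
  from *(1) *(2) show ?case by blast
qed

section \<open>Passing to request times\<close>

text \<open>Each consumed link contributes 1/4 plus its excess, and the common divisor N m cancels.
  Positivity of \<open>req_occ_avg\<close> rules out both N m = 0 and an empty set of consumed
  links.\<close>

lemma avg_consumed_fidelity_eq:
  assumes reg: "regular \<omega>" and inf: "infinite {t. t \<ge> 1 \<and> X t \<omega>}"
  defines "N \<equiv> \<lambda>m. enumerate {t. t \<ge> 1 \<and> X t \<omega>} m - 1"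
  assumes C: "req_occ_avg \<omega> (N m) > 0"
  shows "avg_consumed_fidelity a b c d \<Gamma> Fnew (\<lambda>t. X t \<omega>) (\<lambda>t. K t \<omega>) (\<lambda>t. Q t \<omega>) (\<lambda>t. W t \<omega>) m
    = req_excess_avg \<omega> (N m) / req_occ_avg \<omega> (N m) + 1/4"
proof -
  define g where "g t = decay \<Gamma> (fid (t - 1) \<omega>)" for t
  have g: "g (Suc t) = excess t \<omega> + 1/4 * occ t \<omega>" for t
    unfolding g_def using decay_fid[of t] by simp
  have pos: "(of_bool (g (Suc t) > 0) :: real) = occ t \<omega>" for t
    using excess_bounds[OF reg, of t] occ_cases[of t \<omega>] by (auto simp: g)
  have prod: "g (Suc t) * occ t \<omega> = excess t \<omega> + 1/4 * occ t \<omega>" for t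
    using excess_bounds[OF reg, of t] occ_cases[of t \<omega>] by (auto simp: g)
  have "avg_consumed_fidelity a b c d \<Gamma> Fnew (\<lambda>t. X t \<omega>) (\<lambda>t. K t \<omega>) (\<lambda>t. Q t \<omega>) (\<lambda>t. W t \<omega>) m
      = (\<Sum>s<N m. of_bool (X (Suc s) \<omega>) * (g (Suc s) * of_bool (g (Suc s) > 0)))
        / (\<Sum>s<N m. of_bool (X (Suc s) \<omega>) * of_bool (g (Suc s) > 0))"
    unfolding avg_consumed_fidelity_def Let_def fidelity_minus_def fid_def[symmetric] g_def[symmetric] N_def
      sum_request_times[OF inf, of "\<lambda>t. g t * of_bool (g t > 0)"]
      sum_request_times[OF inf, of "\<lambda>t. of_bool (g t > 0)"] ..
  also have "\<dots> = ((\<Sum>s<N m. of_bool (X (Suc s) \<omega>) * excess s \<omega>) + 1/4 * (\<Sum>s<N m. of_bool (X (Suc s) \<omega>) * occ s \<omega>))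
        / (\<Sum>s<N m. of_bool (X (Suc s) \<omega>) * occ s \<omega>)"
    unfolding pos prod by (simp add: distrib_left sum.distrib sum_distrib_left mult_ac del: sum_of_bool_mult_eq sum_mult_of_bool_eq)
  also have "\<dots> = req_excess_avg \<omega> (N m) / req_occ_avg \<omega> (N m) + 1/4"
    using C by (auto simp: req_occ_avg_def req_excess_avg_def field_simps zero_less_divide_iff)
  finally show ?thesis .
qed

text \<open>Finitely many requests would force \<open>req_occ_avg\<close> to decay like 1 / N, so
  the lower bound already obtained gives infinitely many without a separate probabilistic
  argument.\<close>

lemma infinite_requests:
  assumes "\<delta> > 0" "\<forall>\<^sub>F N in sequentially. \<delta> \<le> req_occ_avg \<omega> N"
  shows "infinite {t. t \<ge> 1 \<and> X t \<omega>}"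
proof
  assume fin: "finite {t. t \<ge> 1 \<and> X t \<omega>}"
  let ?c = "real (card {t. t \<ge> 1 \<and> X t \<omega>})"
  have "req_occ_avg \<omega> N \<le> ?c / real N" for N
  proof -
    have "(\<Sum>t<N. of_bool (X (Suc t) \<omega>) * occ t \<omega>) \<le> (\<Sum>t<N. of_bool (X (Suc t) \<omega>))"
      by (intro sum_mono) (auto simp: occ_def)
    also have "\<dots> = real (card {t \<in> {..<N}. X (Suc t) \<omega>})"
      by (simp add: of_bool_def sum.If_cases Collect_conj_eq Int_commute lessThan_def)
    also have "card {t \<in> {..<N}. X (Suc t) \<omega>} = card (Suc ` {t \<in> {..<N}. X (Suc t) \<omega>})"
      by (simp add: card_image)
    also have "\<dots> \<le> card {t. t \<ge> 1 \<and> X t \<omega>}"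
      by (intro card_mono fin) auto
    finally show ?thesis by (simp add: req_occ_avg_def divide_right_mono)
  qed
  then have "\<forall>\<^sub>F N in sequentially. \<delta> \<le> ?c / real N"
    using assms(2) by (auto elim!: eventually_mono intro: order_trans)
  then have "\<delta> \<le> 0"
    by (intro tendsto_lowerbound[OF lim_const_over_n[of ?c]]) auto
  with assms show False by simp
qed

lemma AE_avg_consumed_fidelity:
  "AE \<omega> in M. avg_consumed_fidelity a b c d \<Gamma> Fnew
       (\<lambda>t. X t \<omega>) (\<lambda>t. K t \<omega>) (\<lambda>t. Q t \<omega>) (\<lambda>t. W t \<omega>)
     \<longlonglongrightarrow> (\<eta> + (Fnew - 1/4) * \<alpha>) / (exp \<Gamma> - \<beta> + (Fnew - 1/4) * \<gamma>) + 1/4"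
  using AE_regular AE_request_averages
proof eventually_elim
  case (elim \<omega>)
  then obtain \<delta> where \<delta>: "\<delta> > 0" "\<forall>\<^sub>F N in sequentially. \<delta> \<le> req_occ_avg \<omega> N" by blast
  note inf = infinite_requests[OF \<delta>]
  let ?N = "\<lambda>m. enumerate {t. t \<ge> 1 \<and> X t \<omega>} m - 1"
  \<comment> \<open>The limit over all horizons is already known, so the random horizons at request
    times only need to diverge.\<close>
  have "m - 1 \<le> ?N m" for m
    using le_enumerate[OF inf, of m] by simp
  then have N: "filterlim ?N at_top sequentially"
    by (intro filterlim_at_top_mono[OF filterlim_minus_const_nat_at_top[of 1]]) auto
  have "(\<lambda>m. req_excess_avg \<omega> (?N m) / req_occ_avg \<omega> (?N m) + 1/4)
      \<longlonglongrightarrow> (\<eta> + (Fnew - 1/4) * \<alpha>) / (exp \<Gamma> - \<beta> + (Fnew - 1/4) * \<gamma>) + 1/4"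
    using elim by (intro tendsto_add tendsto_const filterlim_compose[OF _ N]) blast
  moreover have "\<forall>\<^sub>F m in sequentially. \<delta> \<le> req_occ_avg \<omega> (?N m)"
    using \<delta>(2) N by (rule eventually_compose_filterlim)
  then have "\<forall>\<^sub>F m in sequentially.
      req_excess_avg \<omega> (?N m) / req_occ_avg \<omega> (?N m) + 1/4
      = avg_consumed_fidelity a b c d \<Gamma> Fnew (\<lambda>t. X t \<omega>) (\<lambda>t. K t \<omega>) (\<lambda>t. Q t \<omega>) (\<lambda>t. W t \<omega>) m"
  proof eventually_elim
    case (elim m)
    then show ?case
      using avg_consumed_fidelity_eq[OF _ inf, of m] \<delta>(1) \<open>regular \<omega>\<close> by simp
  qed
  ultimately show ?case
    using tendsto_cong by fast
qed

end

theorem theorem2: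
  fixes M :: "'a measure"
    and n :: nat
    and p_gen p_con q \<Gamma> Fnew :: real
    and a b c d :: "nat \<Rightarrow> real"
    and X Q :: "nat \<Rightarrow> 'a \<Rightarrow> bool"
    and K :: "nat \<Rightarrow> 'a \<Rightarrow> nat"
    and W :: "nat \<Rightarrow> 'a \<Rightarrow> real"
  assumes "n \<ge> 1"
    and "0 < p_gen" "p_gen \<le> 1"
    and "0 < p_con" "p_con \<le> 1"
    and "0 \<le> q" "q \<le> 1"
    and "\<Gamma> \<ge> 0"
    and "1/4 < Fnew" "Fnew \<le> 1"
    and "physical_policy n a b c d"
    and "prob_space M"
    and "\<And>t. t \<ge> 1 \<Longrightarrow> X t \<in> measurable M (count_space UNIV)"
    and "\<And>t. t \<ge> 1 \<Longrightarrow> K t \<in> measurable M (count_space UNIV)"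
    and "\<And>t. t \<ge> 1 \<Longrightarrow> Q t \<in> measurable M (count_space UNIV)"
    and "\<And>t. t \<ge> 1 \<Longrightarrow> W t \<in> borel_measurable M"
    and "\<And>t. t \<ge> 1 \<Longrightarrow> distr M (count_space UNIV) (X t) = measure_pmf (bernoulli_pmf p_con)"
    and "\<And>t. t \<ge> 1 \<Longrightarrow> distr M (count_space UNIV) (K t) = measure_pmf (binomial_pmf n p_gen)"
    and "\<And>t. t \<ge> 1 \<Longrightarrow> distr M (count_space UNIV) (Q t) = measure_pmf (bernoulli_pmf q)"
    and "\<And>t. t \<ge> 1 \<Longrightarrow> distr M borel (W t) = uniform_measure lborel {0..1}"
    and "prob_space.indep_vars M (\<lambda>_. borel) (\<lambda>(s, t). driving X K Q W s t) (UNIV \<times> {1..})"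
  shows "let p_star = 1 - (1 - p_gen) ^ n;
             a' = binomial_mean n p_gen a;
             b' = binomial_mean n p_gen b;
             c' = binomial_mean n p_gen c;
             d' = binomial_mean n p_gen d;
             w' = p_con + q * (1 - p_con) * (p_star + 1/4 * c' - d');
             x' = 1/4 * (exp \<Gamma> - 1 + q * (1 - p_con) * (- a' + 4 * b' - 1/4 * c' + d'));
             y' = q * (1 - p_con) * c';
             z' = exp \<Gamma> - 1 + p_con + q * (1 - p_con) * (p_star - a' - 1/4 * c')
         in AE \<omega> in M.
              avg_consumed_fidelity a b c d \<Gamma> Fnew
                (\<lambda>t. X t \<omega>) (\<lambda>t. K t \<omega>) (\<lambda>t. Q t \<omega>) (\<lambda>t. W t \<omega>)
              \<longlonglongrightarrow> (w' * Fnew + x') / (y' * Fnew + z')"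
proof -
  interpret prob_space M by fact
  interpret purification_system M X Q K W n p_gen p_con q \<Gamma> Fnew a b c d
    by unfold_locales (use assms in auto)
  define f e where "f = Fnew - 1/4" and "e = exp \<Gamma>"
  have D: "e - \<beta> + f * \<gamma> \<noteq> 0"
    using denominator_pos by (simp add: f_def e_def)
  have denom: "q * (1 - p_con) * binomial_mean n p_gen c * Fnew + (e - 1 + p_con + q * (1 - p_con) *
      (p_star - binomial_mean n p_gen a - 1/4 * binomial_mean n p_gen c)) = e - \<beta> + f * \<gamma>"
    by (simp add: \<beta>_def \<gamma>_def f_def field_simps)
  \<comment> \<open>The additive 1/4 of the limit is absorbed into the numerator as a quarter of the
    denominator; this is the origin of the factor 1/4 and of the exponential in x'.\<close>
  have num: "(p_con + q * (1 - p_con) * (p_star + 1/4 * binomial_mean n p_gen c - binomial_mean n p_gen d)) * Fnew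
      + 1/4 * (e - 1 + q * (1 - p_con) * (- binomial_mean n p_gen a + 4 * binomial_mean n p_gen b
        - 1/4 * binomial_mean n p_gen c + binomial_mean n p_gen d))
      = (\<eta> + f * \<alpha>) + 1/4 * (e - \<beta> + f * \<gamma>)"
    by (simp add: \<alpha>_def \<beta>_def \<gamma>_def \<eta>_def f_def field_simps)
  have "(u + 1/4 * \<Delta>) / \<Delta> = u / \<Delta> + 1/4" if "\<Delta> \<noteq> 0" for u \<Delta> :: real
    using that by (simp add: field_simps)
  note quot = this[OF D, of "\<eta> + f * \<alpha>"]
  show ?thesis
    unfolding Let_def p_star_def[symmetric] e_def[symmetric] denom num quot
    using AE_avg_consumed_fidelity[folded e_def f_def] .
qed

end
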